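(* Let $A$ be a $2\times 2$ expanding integer matrix, $f=f_A:\mathbb{T}^2\to\mathbb{T}^2$ the induced expanding toral endomorphism, and $\mathcal{M}$ a Markov partition for $f$. Then the following are true: 1. If $A$ has real, irrational eigenvalues of different modulus, then $\mathcal{M}$ is essentially nowhere smooth. 2. If $A$ has complex (non-real) eigenvalues with arguments that are not a rational multiple of $\pi$, then $\mathcal{M}$ is nowhere differentiable. 3. If $A$ is not diagonalizable (over $\mathbb{C}$), then $\mathcal{M}$ is not smooth, but may be hybrid (that is, there exist a non-diagonalizable expanding $2\times2$ integer matrix and a Markov partition for its induced endomorphism that is hybrid).
   Context: A $d\times d$ integer matrix $A$ is expanding if all its (complex) eigenvalues have modulus strictly greater than $1$. It induces the expanding toral endomorphism $f_A:\mathbb{T}^d\to\mathbb{T}^d$, $\mathbb{T}^d=\mathbb{R}^d/\mathbb{Z}^d$, $f_A(x+\mathbb{Z}^d)=Ax+\mathbb{Z}^d$. The torus carries the standard quotient metric induced by the Euclidean metric. A set $R$ in a compact metric space $X$ is proper if $R=\overline{\operatorname{int}(R)}\neq\emptyset$. A Markov partition for a positively expansive system $(X,f)$ is a finite cover $\mathcal{M}=\{R_i\}_{i=1}^n$ of $X$ by proper sets with pairwise disjoint interiors such that: (1) (metrically generating) for all $(x_k)_{k\ge 0}\in\{1,\dots,n\}^{\mathbb{N}}$, the set $\bigcap_{k=0}^\infty f^{-k}(\operatorname{int}(R_{x_k}))$ consists of at most one point; (2) (Markov property) for all $R,R'\in\mathcal{M}$, if $f(\operatorname{int}(R))\cap\operatorname{int}(R')\neq\emptyset$,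 then each $y\in\operatorname{int}(R')$ has a unique preimage under $f$ in $R$. (Every expanding toral endomorphism is positively expansive.) The boundary of $\mathcal{M}$ is $\partial\mathcal{M}:=\bigcup_{R\in\mathcal{M}}\partial R$. For a Markov partition $\mathcal{M}$ of an expanding toral endomorphism on $\mathbb{T}^2$, call $\mathcal{M}$: - smooth if $\partial\mathcal{M}$ is piecewise $C^1$ (a finite union of $C^1$ arcs); - hybrid if $\partial\mathcal{M}$ is not piecewise $C^1$, but contains a $C^1$ arc; - essentially nowhere smooth if $\partial\mathcal{M}$ contains no $C^1$ arcs; - nowhere differentiable if for every continuous injection $\gamma:[0,1]\to\partial\mathcal{M}$ and every $t\in[0,1]$, either $\gamma$ is not differentiable at $t$ or $\gamma'(t)=0$. Here a $C^1$ arc is the image of an injective $C^1$ map $[0,1]\to\mathbb{T}^2$ with nowhere vanishing derivative; differentiability of maps into $\mathbb{T}^2$ is understood through lifts to $\mathbb{R}^2$ (one-sided at the endpoints of $[0,1]$). *)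

theory Defs
  imports "HOL-Analysis.Analysis"
begin

section \<open>The torus with its quotient metric\<close>

quotient_type (overloaded) 'n torus = "real ^ 'n::finite" / "\<lambda>x y. \<forall>i. x $ i - y $ i \<in> \<int>"
  morphisms torus_rep torus_proj
proof (rule equivpI)
  show "reflp (\<lambda>(x::real^'n) y. \<forall>i. x $ i - y $ i \<in> \<int>)"
    by (simp add: reflp_def)
  show "symp (\<lambda>(x::real^'n) y. \<forall>i. x $ i - y $ i \<in> \<int>)"
    unfolding symp_def by (metis Ints_minus minus_diff_eq)
  show "transp (\<lambda>(x::real^'n) y. \<forall>i. x $ i - y $ i \<in> \<int>)"
    unfolding transp_def by (metis Ints_add diff_add_cancel add_diff_eq)
qed

lemma torus_proj_eq_iff: "torus_proj x = torus_proj y \<longleftrightarrow> (\<forall>i. x $ i - y $ i \<in> \<int>)"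
  by (simp add: torus.abs_eq_iff)

lemma torus_proj_surj: "\<exists>x. torus_proj x = p"
  by (induction p) auto

instantiation torus :: (finite) metric_space
begin

definition dist_torus :: "'a torus \<Rightarrow> 'a torus \<Rightarrow> real" where
  "dist_torus p q = Inf {dist x y | x y. torus_proj x = p \<and> torus_proj y = q}"

definition uniformity_torus :: "('a torus \<times> 'a torus) filter" where
  "uniformity_torus = (INF e\<in>{0<..}. principal {(x, y). dist x y < e})"

definition open_torus :: "'a torus set \<Rightarrow> bool" where
  "open_torus U \<longleftrightarrow> (\<forall>x\<in>U. \<forall>\<^sub>F (x', y) in uniformity. x' = x \<longrightarrow> y \<in> U)"

lemma dist_torus_le: "dist (torus_proj x) (torus_proj y) \<le> dist x y"
  unfolding dist_torus_def by (rule cInf_lower) (auto intro!: bdd_belowI[of _ 0])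

lemma dist_torus_approx:
  fixes p q :: "'a torus"
  assumes "e > 0"
  obtains x y where "torus_proj x = p" "torus_proj y = q" "dist x y < dist p q + e"
proof -
  obtain x0 y0 where "torus_proj x0 = p" "torus_proj y0 = q"
    using torus_proj_surj by meson
  then have ne: "{dist x y | x y. torus_proj x = p \<and> torus_proj y = q} \<noteq> {}"
    by blast
  have "Inf {dist x y | x y. torus_proj x = p \<and> torus_proj y = q} < dist p q + e"
    using assms by (simp add: dist_torus_def)
  from cInf_lessD[OF ne this] show ?thesis
    using that by blast
qed

instance
proof
  fix p q r :: "'a torus"
  show "dist p q = 0 \<longleftrightarrow> p = q"
  proof
    assume "p = q"
    obtain x where x: "torus_proj x = p" using torus_proj_surj by blast
    have "dist p q \<le> 0"
      using dist_torus_le[of x x] x \<open>p = q\<close> by simp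
    moreover have "dist p q \<ge> 0"
      unfolding dist_torus_def
      by (rule cInf_greatest) (use x \<open>p = q\<close> in auto)
    ultimately show "dist p q = 0" by simp
  next
    assume 0: "dist p q = 0"
    obtain x y where xy: "torus_proj x = p" "torus_proj y = q"
      using torus_proj_surj by meson
    have near: "\<exists>k. k \<in> \<int> \<and> \<bar>x $ i - y $ i - k\<bar> < e" if "e > 0" for e i
    proof -
      obtain x' y' where x'y': "torus_proj x' = p" "torus_proj y' = q" "dist x' y' < e"
        using dist_torus_approx[OF \<open>e > 0\<close>, of p q] 0 by auto
      have "x $ i - x' $ i \<in> \<int>" "y $ i - y' $ i \<in> \<int>"
        using x'y' xy by (metis torus_proj_eq_iff)+
      then have "(x $ i - x' $ i) - (y $ i - y' $ i) \<in> \<int>" by (rule Ints_diff)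
      moreover have "\<bar>x $ i - y $ i - ((x $ i - x' $ i) - (y $ i - y' $ i))\<bar> < e"
        using dist_vec_nth_le[of x' i y'] x'y'(3) by (simp add: dist_real_def)
      ultimately show ?thesis by blast
    qed
    have "x $ i - y $ i \<in> \<int>" for i
    proof -
      have "infdist (x $ i - y $ i) \<int> \<le> 0"
      proof (rule field_le_epsilon)
        fix e :: real assume "e > 0"
        then obtain k where "k \<in> \<int>" "\<bar>x $ i - y $ i - k\<bar> < e" using near by blast
        then show "infdist (x $ i - y $ i) \<int> \<le> 0 + e"
          using infdist_le[of k \<int> "x $ i - y $ i"] by (simp add: dist_real_def)
      qed
      then have "infdist (x $ i - y $ i) \<int> = 0"
        using infdist_nonneg[of "x $ i - y $ i" \<int>] by linarith
      moreover have "closed (\<int> :: real set)" by (rule closed_Ints)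
      ultimately show ?thesis
        using in_closed_iff_infdist_zero[of "\<int> :: real set"] by auto
    qed
    then show "p = q" using xy torus_proj_eq_iff by metis
  qed
  show "dist p q \<le> dist p r + dist q r"
  proof (rule field_le_epsilon)
    fix e :: real assume "e > 0"
    then have e: "e / 2 > 0" by simp
    obtain x z where xz: "torus_proj x = p" "torus_proj z = r" "dist x z < dist p r + e / 2"
      using dist_torus_approx[OF e] .
    obtain y w where yw: "torus_proj y = q" "torus_proj w = r" "dist y w < dist q r + e / 2"
      using dist_torus_approx[OF e] .
    define y' where "y' = y - w + z"
    have "torus_proj y' = torus_proj y"
      unfolding torus_proj_eq_iff
      using xz(2) yw(2) torus_proj_eq_iff[of z w] by (simp add: y'_def)
    then have "dist p q \<le> dist x y'"
      using dist_torus_le[of x y'] xz yw by simp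
    also have "\<dots> \<le> dist x z + dist y' z" by (rule dist_triangle2)
    also have "dist y' z = dist y w" by (simp add: y'_def dist_norm)
    finally show "dist p q \<le> dist p r + dist q r + e" using xz yw by simp
  qed
qed (rule uniformity_torus_def open_torus_def)+

end

lemma compact_torus: "compact (UNIV :: 'n::finite torus set)"
proof -
  have "continuous_on (cbox 0 1) (torus_proj :: real^'n \<Rightarrow> _)"
    unfolding continuous_on_iff by (metis dist_torus_le le_less_trans)
  then have "compact (torus_proj ` cbox 0 (1 :: real^'n))"
    by (rule compact_continuous_image) simp
  moreover have "p \<in> torus_proj ` cbox 0 (1 :: real^'n)" for p
  proof -
    obtain x where "torus_proj x = p" using torus_proj_surj by blast
    moreover have "torus_proj (\<chi> i. frac (x $ i)) = torus_proj x"
      unfolding torus_proj_eq_iff by (simp add: frac_def)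
    moreover have "(\<chi> i. frac (x $ i)) \<in> cbox 0 (1 :: real^'n)"
      by (simp add: mem_box_cart less_imp_le[OF frac_lt_1])
    ultimately show ?thesis by (metis imageI)
  qed
  ultimately show ?thesis by (metis UNIV_eq_I)
qed


section \<open>Expanding toral endomorphisms\<close>

definition complex_eigenvalue :: "int ^ 'n ^ 'n \<Rightarrow> complex \<Rightarrow> bool" where
  "complex_eigenvalue A l \<longleftrightarrow> (\<exists>v. v \<noteq> 0 \<and> map_matrix of_int A *v v = l *s v)"

definition expanding :: "int ^ 'n ^ 'n \<Rightarrow> bool" where
  "expanding A \<longleftrightarrow> (\<forall>l. complex_eigenvalue A l \<longrightarrow> cmod l > 1)"

definition complex_diagonalizable :: "int ^ 'n ^ 'n \<Rightarrow> bool" where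
  "complex_diagonalizable A \<longleftrightarrow>
    (\<exists>P D :: complex ^ 'n ^ 'n. invertible P \<and> (\<forall>i j. i \<noteq> j \<longrightarrow> D $ i $ j = 0) \<and>
       map_matrix of_int A = P ** D ** matrix_inv P)"

lift_definition toral_endomorphism :: "int ^ 'n ^ 'n \<Rightarrow> 'n::finite torus \<Rightarrow> 'n torus"
  is "\<lambda>A x. map_matrix real_of_int A *v x"
proof -
  fix A :: "int ^ 'n ^ 'n" and x y :: "real ^ 'n" and i
  assume "\<And>i. x $ i - y $ i \<in> \<int>"
  then show "(map_matrix real_of_int A *v x) $ i - (map_matrix real_of_int A *v y) $ i \<in> \<int>"
    by (auto simp: matrix_vector_mult_def sum_subtractf[symmetric] right_diff_distrib[symmetric]
        intro!: Ints_sum Ints_mult)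
qed


section \<open>Markov partitions\<close>

definition proper_set :: "'a::topological_space set \<Rightarrow> bool" where
  "proper_set R \<longleftrightarrow> R = closure (interior R) \<and> R \<noteq> {}"

text \<open>
  A family of proper sets with pairwise disjoint interiors is automatically injective, so the
  indexed family \<open>R\<^sub>1, \<dots>, R\<^sub>n\<close> is given by its set of members.
\<close>

definition markov_partition :: "('a::metric_space \<Rightarrow> 'a) \<Rightarrow> 'a set set \<Rightarrow> bool" where
  "markov_partition f M \<longleftrightarrow>
     finite M \<and> \<Union>M = UNIV \<and> (\<forall>R\<in>M. proper_set R) \<and>
     (\<forall>R\<in>M. \<forall>R'\<in>M. R \<noteq> R' \<longrightarrow> interior R \<inter> interior R' = {}) \<and>
     (\<forall>X :: nat \<Rightarrow> 'a set. (\<forall>k. X k \<in> M) \<longrightarrow>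
        (\<forall>p q. p \<in> (\<Inter>k. (f ^^ k) -` interior (X k)) \<and> q \<in> (\<Inter>k. (f ^^ k) -` interior (X k))
           \<longrightarrow> p = q)) \<and>
     (\<forall>R\<in>M. \<forall>R'\<in>M. f ` interior R \<inter> interior R' \<noteq> {} \<longrightarrow>
        (\<forall>y\<in>interior R'. \<exists>!x. x \<in> R \<and> f x = y))"

definition partition_boundary :: "'a::topological_space set set \<Rightarrow> 'a set" where
  "partition_boundary M = (\<Union>R\<in>M. frontier R)"


section \<open>Regularity of the boundary\<close>

text \<open>
  Continuous lifts of a path differ by a constant integer vector, so the derivative does not
  depend on the lift. The filter \<open>at t within {0..1}\<close> gives one-sided derivatives at the endpoints.
\<close>

definition has_torus_derivative :: "(real \<Rightarrow> 'n::finite torus) \<Rightarrow> real ^ 'n \<Rightarrow> real \<Rightarrow> bool" where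
  "has_torus_derivative c v t \<longleftrightarrow>
     (\<exists>g. continuous_on {0..1} g \<and> (\<forall>s\<in>{0..1}. c s = torus_proj (g s)) \<and>
          (g has_vector_derivative v) (at t within {0..1}))"

definition C1_arc :: "'n::finite torus set \<Rightarrow> bool" where
  "C1_arc C \<longleftrightarrow>
     (\<exists>c c'. inj_on c {0..1} \<and> C = c ` {0..1} \<and> continuous_on {0..1} c' \<and>
        (\<forall>t\<in>{0..1}. has_torus_derivative c (c' t) t \<and> c' t \<noteq> 0))"

definition smooth_partition :: "'n::finite torus set set \<Rightarrow> bool" where
  "smooth_partition M \<longleftrightarrow>
     (\<exists>\<C>. finite \<C> \<and> (\<forall>C\<in>\<C>. C1_arc C) \<and> partition_boundary M = \<Union>\<C>)"

definition hybrid_partition :: "'n::finite torus set set \<Rightarrow> bool" where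
  "hybrid_partition M \<longleftrightarrow>
     \<not> smooth_partition M \<and> (\<exists>C. C1_arc C \<and> C \<subseteq> partition_boundary M)"

definition essentially_nowhere_smooth :: "'n::finite torus set set \<Rightarrow> bool" where
  "essentially_nowhere_smooth M \<longleftrightarrow> \<not> (\<exists>C. C1_arc C \<and> C \<subseteq> partition_boundary M)"

definition nowhere_differentiable :: "'n::finite torus set set \<Rightarrow> bool" where
  "nowhere_differentiable M \<longleftrightarrow>
     (\<forall>c. continuous_on {0..1} c \<and> inj_on c {0..1} \<and> c ` {0..1} \<subseteq> partition_boundary M \<longrightarrow>
        (\<forall>t\<in>{0..1}. \<not> (\<exists>v. has_torus_derivative c v t) \<or> has_torus_derivative c 0 t))"

end

theory Submission
  imports Defs
begin

text \<open>
  The boundary \<open>B\<close> of a Markov partition is closed, is not the whole torus, and satisfies \<open>f B \<subseteq> B\<close>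
  (\<open>closed_partition_boundary\<close>, \<open>partition_boundary_neq_UNIV\<close>,
  \<open>partition_boundary_forward_invariant\<close>). The negative statements rest on this: a smooth piece
  of \<open>B\<close> is magnified by the iterates of \<open>A\<close> until its images, which stay in \<open>B\<close>, would fill the torus.

  Let a curve in \<open>B\<close> have derivative \<open>v \<noteq> 0\<close> at a time \<open>t\<close>. On a time interval of length about
  \<open>1 / \<bar>A\<^sup>n v\<bar>\<close> the \<open>n\<close>-th image of the curve is close to a straight segment in the direction
  \<open>A\<^sup>n v\<close>, and a compactness argument puts a whole ray with a limiting direction into \<open>B\<close>
  (\<open>boundary_contains_ray\<close>). By Kronecker's theorem a ray of irrational slope is dense, so no such
  direction can occur (\<open>no_irrational_blow_up\<close>). If \<open>A\<close> has a non-real eigenvalue \<open>l\<close> whose argument is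
  not a rational multiple of \<open>\<pi>\<close>, then in suitable coordinates \<open>A\<close> is multiplication by \<open>l\<close> on \<open>\<complex>\<close>,
  the directions \<open>A\<^sup>n v\<close> are dense in the circle, and an irrational one can be chosen as limit. If \<open>A\<close>
  has irrational real eigenvalues of different modulus, the directions converge to the eigenline of the
  larger one, unless the tangents of the arc always lie in the other eigenline; then the arc is a segment of
  that line. Both eigenlines have irrational slope.

  If \<open>A\<close> is not diagonalizable, then \<open>A x = L x + \<kappa> det (e, x) e\<close> with an integer \<open>L\<close>, \<open>\<bar>L\<bar> \<ge> 2\<close>, and
  an integral eigenvector \<open>e\<close>. Now the limiting rays are closed circles, and a finer scale is needed: while
  the \<open>n\<close>-th image of an arc transverse to \<open>e\<close> advances by one unit across the direction of \<open>e\<close>, it winds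
  about \<open>n\<close> times along \<open>e\<close>, so these images become dense (\<open>sheared_curve_dense\<close>). Hence a
  smooth boundary is contained in finitely many circles parallel to \<open>e\<close>. Any other circle parallel to
  \<open>e\<close> lies inside a single cell, but \<open>f\<close> maps it onto its image with degree \<open>L\<close>, contrary to the
  uniqueness of preimages within a cell (\<open>nondiagonalizable_not_smooth\<close>).

  For the hybrid example take \<open>A = ((8, 1), (0, 8))\<close> and replace the first coordinate by
  \<open>height x = x\<^sub>1 - skew x\<^sub>2\<close>, where \<open>skew y = - (\<Sum>n. frac (8\<^sup>n y) / 8\<^sup>n\<^sup>+\<^sup>1)\<close>. Modulo integers, \<open>f\<close>
  multiplies both \<open>height\<close> and \<open>x\<^sub>2\<close> by \<open>8\<close>, so the 64 closed squares of side \<open>1/8\<close> in these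
  coordinates are the natural cells. The function \<open>skew\<close> jumps at rationals with denominator a power of
  \<open>8\<close>, but points with irrational coordinates are dense and interior to their cell, and every property of a
  Markov partition can be tested on them (\<open>markov_partition_tiling\<close>). The circle \<open>x\<^sub>2 = 0\<close> belongs to
  the boundary and contains a smooth arc, while the boundary as a whole is not smooth since \<open>A\<close> is not
  diagonalizable.
\<close>

section \<open>The torus and its endomorphisms\<close>

abbreviation linear_lift :: "int ^ 'n ^ 'n \<Rightarrow> real ^ 'n \<Rightarrow> real ^ 'n" where
  "linear_lift A x \<equiv> map_matrix real_of_int A *v x"

lemma toral_endomorphism_proj:
  "toral_endomorphism A (torus_proj x) = torus_proj (linear_lift A x)"
  by (rule toral_endomorphism.abs_eq)

lemma toral_endomorphism_funpow_proj:
  "(toral_endomorphism A ^^ n) (torus_proj x) = torus_proj ((linear_lift A ^^ n) x)"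
  by (induction n) (simp_all add: toral_endomorphism_proj)

lemma linear_lift_funpow_linear: "linear (linear_lift A ^^ n)"
proof (induction n)
  case 0
  show ?case using linear_id by (simp add: id_def)
next
  case (Suc n)
  have "linear (linear_lift A \<circ> (linear_lift A ^^ n))"
    by (rule linear_compose[OF Suc matrix_vector_mul_linear])
  then show ?case by (simp add: o_def)
qed

lemma torus_proj_cong_add:
  assumes "torus_proj a = torus_proj b"
  shows "torus_proj (a + d) = torus_proj (b + d)"
  using assms by (simp add: torus_proj_eq_iff)

lemma torus_proj_add_integer:
  assumes "\<And>i. k $ i \<in> \<int>"
  shows "torus_proj (x + k) = torus_proj x"
  using assms by (simp add: torus_proj_eq_iff)

lemma torus_proj_lift_near:
  assumes "e > 0"
  obtains z where "torus_proj z = q" "dist x z < dist (torus_proj x) q + e"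
proof -
  obtain a b where ab: "torus_proj a = torus_proj x" "torus_proj b = q"
      "dist a b < dist (torus_proj x) q + e"
    using dist_torus_approx[OF assms] by metis
  have "torus_proj (b + (x - a)) = torus_proj b"
    using ab(1)[symmetric] by (intro torus_proj_add_integer) (simp add: torus_proj_eq_iff)
  moreover have "dist x (b + (x - a)) = dist a b"
    by (simp add: dist_norm algebra_simps)
  ultimately show ?thesis using that ab by metis
qed

lemma dist_torus_proj_translate:
  "dist (torus_proj (a + d)) (torus_proj (b + d)) \<le> dist (torus_proj a) (torus_proj b)"
proof (rule field_le_epsilon)
  fix e :: real assume "e > 0"
  then obtain z where z: "torus_proj z = torus_proj b" "dist a z < dist (torus_proj a) (torus_proj b) + e"
    using torus_proj_lift_near by blast
  have "dist (torus_proj (a + d)) (torus_proj (z + d)) \<le> dist (a + d) (z + d)"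
    by (rule dist_torus_le)
  then show "dist (torus_proj (a + d)) (torus_proj (b + d)) \<le> dist (torus_proj a) (torus_proj b) + e"
    using z torus_proj_cong_add[OF z(1), of d] by simp
qed

lemma tendsto_torus_proj:
  assumes "(g \<longlongrightarrow> x) F"
  shows "((\<lambda>s. torus_proj (g s)) \<longlongrightarrow> torus_proj x) F"
  unfolding tendsto_iff
proof (intro allI impI)
  fix e :: real assume "e > 0"
  with assms have "\<forall>\<^sub>F s in F. dist (g s) x < e" by (simp add: tendsto_iff)
  then show "\<forall>\<^sub>F s in F. dist (torus_proj (g s)) (torus_proj x) < e"
    by eventually_elim (meson dist_torus_le le_less_trans)
qed

lemma continuous_on_torus_proj: "continuous_on S torus_proj"
  unfolding continuous_on_def by (auto intro!: tendsto_torus_proj)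

lemma open_vimage_torus_proj: "open U \<Longrightarrow> open (torus_proj -` U)"
  by (simp add: open_vimage continuous_on_torus_proj)

lemma toral_endomorphism_lipschitz:
  obtains K where "K > 0" "\<And>p q. dist (toral_endomorphism A p) (toral_endomorphism A q) \<le> K * dist p q"
proof -
  obtain K where K: "K > 0" "\<And>x. norm (linear_lift A x) \<le> norm x * K"
    using bounded_linear.pos_bounded[OF matrix_vector_mul_bounded_linear[of "map_matrix real_of_int A"]]
    by blast
  have "dist (toral_endomorphism A p) (toral_endomorphism A q) \<le> K * dist p q" for p q
  proof (rule field_le_epsilon)
    fix e :: real assume "e > 0"
    then have "e / K > 0" using K by simp
    then obtain x y where xy: "torus_proj x = p" "torus_proj y = q" "dist x y < dist p q + e / K"
      by (rule dist_torus_approx)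
    have "dist (toral_endomorphism A p) (toral_endomorphism A q) \<le> dist (linear_lift A x) (linear_lift A y)"
      unfolding xy(1,2)[symmetric] toral_endomorphism_proj by (rule dist_torus_le)
    also have "\<dots> \<le> dist x y * K"
      using K(2)[of "x - y"] by (simp add: dist_norm matrix_vector_mult_diff_distrib)
    also have "\<dots> \<le> (dist p q + e / K) * K"
      using xy K by (intro mult_right_mono) auto
    also have "\<dots> = K * dist p q + e" using K by (simp add: field_simps)
    finally show "dist (toral_endomorphism A p) (toral_endomorphism A q) \<le> K * dist p q + e" .
  qed
  then show ?thesis using that K by blast
qed

lemma continuous_on_toral_endomorphism: "continuous_on S (toral_endomorphism A)"
proof -
  obtain K where K: "K > 0" "\<And>p q. dist (toral_endomorphism A p) (toral_endomorphism A q) \<le> K * dist p q"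
    using toral_endomorphism_lipschitz by blast
  show ?thesis
    unfolding continuous_on_iff
  proof (intro ballI allI impI)
    fix p and e :: real assume "e > 0"
    have "dist (toral_endomorphism A q) (toral_endomorphism A p) < e" if "dist q p < e / K" for q
      using K(2)[of q p] that K(1) by (simp add: field_simps) 
    then show "\<exists>d>0. \<forall>x'\<in>S. dist x' p < d \<longrightarrow> dist (toral_endomorphism A x') (toral_endomorphism A p) < e"
      using \<open>e > 0\<close> K(1) by (intro exI[of _ "e / K"]) auto
  qed
qed

lemma continuous_on_funpow_toral_endomorphism: "continuous_on UNIV (toral_endomorphism A ^^ n)"
proof (induction n)
  case (Suc n)
  have "continuous_on UNIV (toral_endomorphism A \<circ> (toral_endomorphism A ^^ n))"
    by (intro continuous_on_compose Suc continuous_on_toral_endomorphism)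
  then show ?case by (simp add: o_def)
qed (simp add: continuous_on_id)

lemma expanding_linear_lift_eq_0:
  assumes "expanding A" "linear_lift A x = 0"
  shows "x = 0"
proof (rule ccontr)
  assume "x \<noteq> 0"
  define v :: "complex ^ 'a" where "v = (\<chi> i. complex_of_real (x $ i))"
  have "v \<noteq> 0" using \<open>x \<noteq> 0\<close> by (simp add: v_def vec_eq_iff)
  moreover have "map_matrix of_int A *v v = 0 *s v"
  proof -
    have "(\<Sum>j\<in>UNIV. of_int (A $ i $ j) * complex_of_real (x $ j)) = 0" for i
    proof -
      have "(\<Sum>j\<in>UNIV. of_int (A $ i $ j) * complex_of_real (x $ j))
          = complex_of_real ((linear_lift A x) $ i)"
        by (simp add: matrix_vector_mult_def)
      then show ?thesis using assms(2) by simp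
    qed
    then show ?thesis
      by (simp add: v_def matrix_vector_mult_def vec_eq_iff)
  qed
  ultimately have "complex_eigenvalue A 0" unfolding complex_eigenvalue_def by blast
  then show False using assms(1) unfolding expanding_def by fastforce
qed

text \<open>
  Two nearby points with the same image have lifts whose difference is mapped to an integer vector of
  norm less than one, that is, to zero; and \<open>A\<close> is injective because \<open>0\<close> is not an eigenvalue.
\<close>
lemma toral_endomorphism_locally_injective:
  fixes A :: "int ^ 'n ^ 'n"
  assumes "expanding A"
  obtains d where "d > 0"
    "\<And>p q. dist p q < d \<Longrightarrow> toral_endomorphism A p = toral_endomorphism A q \<Longrightarrow> p = q"
proof -
  obtain K where K: "K > 0" "\<And>x. norm (linear_lift A x) \<le> norm x * K"
    using bounded_linear.pos_bounded[OF matrix_vector_mul_bounded_linear[of "map_matrix real_of_int A"]]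
    by blast
  have "p = q" if d: "dist p q < 1 / K" and eq: "toral_endomorphism A p = toral_endomorphism A q" for p q
  proof -
    have "1 / K - dist p q > 0" using d by simp
    then obtain x y where xy: "torus_proj x = p" "torus_proj y = q" "dist x y < dist p q + (1 / K - dist p q)"
      by (rule dist_torus_approx)
    let ?z = "linear_lift A (x - y)"
    have int: "?z $ i \<in> \<int>" for i
      using eq unfolding xy(1,2)[symmetric] toral_endomorphism_proj torus_proj_eq_iff
      by (simp add: matrix_vector_mult_diff_distrib)
    have "norm ?z < 1"
    proof -
      have "norm ?z \<le> norm (x - y) * K" by (rule K)
      also have "\<dots> < 1 / K * K" using xy(3) K(1) by (intro mult_strict_right_mono) (auto simp: dist_norm)
      finally show ?thesis using K(1) by simp
    qed
    then have "\<bar>?z $ i\<bar> < 1" for i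
      using component_le_norm_cart[of ?z i] by linarith
    then have "?z $ i = 0" for i
      using int[of i] by (metis Ints_nonzero_abs_less1)
    then have "?z = 0" by (simp add: vec_eq_iff)
    then have "x - y = 0" using expanding_linear_lift_eq_0[OF assms] by blast
    then show "p = q" using xy by simp
  qed
  then show ?thesis using that[of "1/K"] K by simp
qed

section \<open>The boundary of a Markov partition\<close>

lemma markov_partition_proper:
  assumes "markov_partition f M" "R \<in> M"
  shows "proper_set R"
  using assms by (simp add: markov_partition_def)

lemma markov_partition_cover:
  assumes "markov_partition f M"
  obtains R where "R \<in> M" "p \<in> R"
proof -
  have "\<Union>M = UNIV" using assms by (simp add: markov_partition_def)
  then show ?thesis using that by blast
qed

lemma markov_partition_disjoint:
  assumes "markov_partition f M" "R \<in> M" "R' \<in> M" "R \<noteq> R'"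
  shows "interior R \<inter> interior R' = {}"
  using assms by (simp add: markov_partition_def)

lemma markov_partition_unique_preimage:
  assumes "markov_partition f M" "R \<in> M" "R' \<in> M" "f ` interior R \<inter> interior R' \<noteq> {}"
    "y \<in> interior R'"
  shows "\<exists>!x. x \<in> R \<and> f x = y"
  using assms by (simp add: markov_partition_def)

lemma proper_set_closure_interior: "proper_set R \<Longrightarrow> closure (interior R) = R"
  by (simp add: proper_set_def)

lemma proper_set_closed: "proper_set R \<Longrightarrow> closed R"
  by (metis proper_set_closure_interior closed_closure)

text \<open>
  Since a cell is the closure of its interior, an open set that misses the interior of a cell misses the cell;
  so the interior of one cell contains no boundary points of another one.
\<close>
lemma Compl_partition_boundary:
  assumes "markov_partition f M"
  shows "- partition_boundary M = (\<Union>R\<in>M. interior R)"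
proof -
  have cl: "closed R" "closure (interior R) = R" if "R \<in> M" for R
    using proper_set_closed proper_set_closure_interior markov_partition_proper[OF assms that] by auto
  have disj: "frontier R \<inter> interior R' = {}" if "R \<in> M" "R' \<in> M" for R R'
  proof (cases "R = R'")
    case True
    then show ?thesis by (auto simp: frontier_def)
  next
    case False
    then have "interior R \<inter> interior R' = {}" using markov_partition_disjoint[OF assms that] by blast
    then have "closure (interior R) \<inter> interior R' = {}"
      using open_Int_closure_eq_empty[OF open_interior, of R' "interior R"] by blast
    moreover have "frontier R \<subseteq> closure (interior R)"
      using frontier_subset_closed[OF cl(1)[OF that(1)]] cl(2)[OF that(1)] by simp
    ultimately show ?thesis by blast
  qed
  have "p \<in> partition_boundary M \<or> p \<in> (\<Union>R\<in>M. interior R)" for p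
  proof -
    obtain R where "R \<in> M" "p \<in> R"
      using markov_partition_cover[OF assms] .
    moreover have "p \<in> frontier R \<or> p \<in> interior R"
      using \<open>p \<in> R\<close> closure_subset[of R] by (auto simp: frontier_def)
    ultimately show ?thesis
      unfolding partition_boundary_def by blast
  qed
  then show ?thesis
    using disj unfolding partition_boundary_def by blast
qed

lemma closed_partition_boundary:
  assumes "markov_partition f M"
  shows "closed (partition_boundary M)"
proof -
  have "open (- partition_boundary M)"
    unfolding Compl_partition_boundary[OF assms] by auto
  then show ?thesis by (simp add: closed_open)
qed

lemma markov_partition_interior_nonempty:
  assumes "markov_partition f M" "R \<in> M"
  shows "interior R \<noteq> {}"
  using proper_set_closure_interior[OF markov_partition_proper[OF assms]]
    markov_partition_proper[OF assms] by (metis closure_empty proper_set_def)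

lemma partition_boundary_neq_UNIV:
  fixes M :: "'a::metric_space set set"
  assumes "markov_partition f M"
  shows "partition_boundary M \<noteq> UNIV"
proof
  assume "partition_boundary M = UNIV"
  then have "(\<Union>R\<in>M. interior R) = {}"
    using Compl_partition_boundary[OF assms] by auto
  moreover have "M \<noteq> {}"
    using markov_partition_cover[OF assms] by blast
  ultimately show False
    using markov_partition_interior_nonempty[OF assms] by blast
qed

text \<open>
  Suppose a boundary point \<open>x\<close> of \<open>R\<close> is mapped into the interior of \<open>R'\<close>. Points \<open>s\<^sub>n \<notin> R\<close>
  converging to \<open>x\<close> have images in \<open>int R'\<close>, and these have preimages \<open>u\<^sub>n \<in> R\<close> by the Markov property.
  Any limit of the \<open>u\<^sub>n\<close> is a preimage of \<open>f x\<close> in \<open>R\<close>, hence \<open>x\<close> by uniqueness. So \<open>u\<^sub>n \<noteq> s\<^sub>n\<close> are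
  close together with the same image, which contradicts local injectivity.
\<close>
lemma partition_boundary_forward_invariant:
  fixes A :: "int ^ 'n ^ 'n"
  assumes "expanding A" and M: "markov_partition (toral_endomorphism A) M"
  shows "toral_endomorphism A ` partition_boundary M \<subseteq> partition_boundary M"
proof
  let ?f = "toral_endomorphism A"
  fix y assume "y \<in> ?f ` partition_boundary M"
  then obtain x R where x: "y = ?f x" "R \<in> M" "x \<in> frontier R"
    unfolding partition_boundary_def by auto
  have ciR: "closure (interior R) = R" and clR: "closed R"
    using markov_partition_proper[OF M x(2)] by (auto simp: proper_set_closure_interior proper_set_closed)
  then have "compact R" using compact_torus compact_Int_closed[of UNIV R] by simp
  have xR: "x \<in> R" using x clR frontier_subset_closed by blast
  show "y \<in> partition_boundary M"
  proof (rule ccontr)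
    assume "y \<notin> partition_boundary M"
    then obtain R' where R': "R' \<in> M" "y \<in> interior R'" using Compl_partition_boundary[OF M] by blast
    define V where "V = ?f -` interior R'"
    have V: "open V" "x \<in> V"
      unfolding V_def using R' x by (auto intro!: open_vimage continuous_on_toral_endomorphism)
    have "interior R \<inter> V \<noteq> {}"
      using xR ciR V open_Int_closure_eq_empty[of V "interior R"] by blast
    then have "?f ` interior R \<inter> interior R' \<noteq> {}" unfolding V_def by blast
    then have uniq: "\<exists>!u. u \<in> R \<and> ?f u = z" if "z \<in> interior R'" for z
      using markov_partition_unique_preimage[OF M x(2) R'(1) _ that] by blast
    have "x \<in> closure (- R)" using x by (simp add: frontier_closures)
    then obtain s where s: "\<And>n. s n \<in> - R" "s \<longlonglongrightarrow> x"
      by (meson closure_sequential)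
    have "\<exists>u. s n \<in> V \<longrightarrow> u \<in> R \<and> ?f u = ?f (s n)" for n
      using uniq[of "?f (s n)"] unfolding V_def by auto
    then obtain u where u: "\<And>n. s n \<in> V \<Longrightarrow> u n \<in> R \<and> ?f (u n) = ?f (s n)" by metis
    have "\<forall>\<^sub>F n in sequentially. s n \<in> V" using s(2) V by (rule topological_tendstoD)
    then obtain n0 where n0: "\<And>n. n \<ge> n0 \<Longrightarrow> s n \<in> V" by (auto simp: eventually_sequentially)
    define s' where "s' n = s (n + n0)" for n
    define u' where "u' n = u (n + n0)" for n
    have s': "s' \<longlonglongrightarrow> x" unfolding s'_def using s(2) by (rule LIMSEQ_ignore_initial_segment)
    have u': "u' n \<in> R" "?f (u' n) = ?f (s' n)" for n
      unfolding u'_def s'_def using u[of "n + n0"] n0[of "n + n0"] by auto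
    obtain w r where w: "w \<in> R" "strict_mono r" "(u' \<circ> r) \<longlonglongrightarrow> w"
      using \<open>compact R\<close> u'(1) unfolding compact_def by metis
    have s'r: "(s' \<circ> r) \<longlonglongrightarrow> x" using s' w(2) by (rule LIMSEQ_subseq_LIMSEQ)
    have cont: "isCont ?f z" for z
      using continuous_on_toral_endomorphism[of UNIV A] by (simp add: continuous_on_eq_continuous_at)
    have "(\<lambda>n. ?f ((u' \<circ> r) n)) \<longlonglongrightarrow> ?f w" using cont w(3) by (rule isCont_tendsto_compose)
    moreover have "(\<lambda>n. ?f ((s' \<circ> r) n)) \<longlonglongrightarrow> ?f x" using cont s'r by (rule isCont_tendsto_compose)
    ultimately have "?f w = ?f x" using u'(2) by (simp add: LIMSEQ_unique)
    then have "w = x" using uniq[of y] R' w(1) xR x(1) by metis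
    obtain d where d: "d > 0" "\<And>p q. dist p q < d \<Longrightarrow> ?f p = ?f q \<Longrightarrow> p = q"
      using toral_endomorphism_locally_injective[OF assms(1)] by blast
    have "(\<lambda>n. dist ((u' \<circ> r) n) ((s' \<circ> r) n)) \<longlonglongrightarrow> dist w x"
      using w(3) s'r by (rule tendsto_dist)
    then have "\<forall>\<^sub>F n in sequentially. dist ((u' \<circ> r) n) ((s' \<circ> r) n) < d"
      using \<open>w = x\<close> d(1) by (intro order_tendstoD) auto
    then obtain n where "dist (u' (r n)) (s' (r n)) < d" by (auto simp: eventually_sequentially)
    then have "u' (r n) = s' (r n)" using d(2) u'(2) by blast
    then show False using u'(1)[of "r n"] s(1)[of "r n + n0"] unfolding s'_def by simp
  qed
qed

lemma forward_invariant_funpow: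
  assumes "f ` B \<subseteq> B" "p \<in> B"
  shows "(f ^^ n) p \<in> B"
  using assms by (induction n) auto

section \<open>Blowing up a point of differentiability\<close>

text \<open>
  The blow-up argument. The scales \<open>\<rho>\<close> are those at which \<open>A\<^sup>N\<^sup>k v\<close> has the limit \<open>w\<close>, so that the image
  of the curve at time \<open>t \<plusminus> s / \<rho> k\<close> is, up to an error, the image at time \<open>t\<close> plus \<open>\<plusminus>s w\<close>. The error
  is \<open>A\<^sup>N\<^sup>k\<close> applied to a vector of size \<open>o(1 / \<rho> k)\<close>, and it vanishes in the limit if \<open>A\<^sup>N\<^sup>k\<close>
  expands by at most a multiple of \<open>\<rho> k\<close>. This bound is only required on a set \<open>S\<close> that contains
  the remainders: for a curve inside a weakly expanded line the bound fails on the whole plane. The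
  sign \<open>\<sigma>\<close> allows \<open>t\<close> to be an endpoint of the interval.
\<close>
lemma boundary_contains_ray:
  fixes A :: "int ^ 'n ^ 'n" and g :: "real \<Rightarrow> real ^ 'n" and \<rho> :: "nat \<Rightarrow> real"
  assumes B: "closed B" "toral_endomorphism A ` B \<subseteq> B"
    and gB: "\<And>s. s \<in> {0..1} \<Longrightarrow> torus_proj (g s) \<in> B"
    and t: "t \<in> {0..1}" and g': "(g has_vector_derivative v) (at t within {0..1})"
    and \<rho>: "filterlim \<rho> at_top sequentially"
    and w: "(\<lambda>k. (1 / \<rho> k) *\<^sub>R (linear_lift A ^^ N k) v) \<longlonglongrightarrow> w"
    and K: "\<And>k x. x \<in> S \<Longrightarrow> norm ((linear_lift A ^^ N k) x) \<le> K * \<rho> k * norm x"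
    and S: "\<And>s. s \<in> {0..1} \<Longrightarrow> g s - g t - (s - t) *\<^sub>R v \<in> S"
  shows "\<exists>x. \<exists>\<sigma>\<in>{1, -1::real}. \<forall>s\<ge>0. torus_proj (x + (s * \<sigma>) *\<^sub>R w) \<in> B"
proof -
  define F where "F k = linear_lift A ^^ N k" for k
  have linF: "linear (F k)" for k unfolding F_def by (rule linear_lift_funpow_linear)
  have FB: "torus_proj (F k (g s)) \<in> B" if "s \<in> {0..1}" for k s
    unfolding F_def toral_endomorphism_funpow_proj[symmetric]
    using forward_invariant_funpow[OF B(2) gB[OF that]] .
  obtain \<sigma> :: real where \<sigma>: "\<sigma> \<in> {1, -1}" "t + \<sigma> / 2 \<in> {0..1}"
  proof (cases "t \<le> 1/2")
    case True
    then show ?thesis using t that[of 1] by auto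
  next
    case False
    then show ?thesis using t that[of "-1"] by auto
  qed
  have "compact B" using compact_torus compact_Int_closed[of UNIV B] B(1) by simp
  then obtain p r where pr: "p \<in> B" "strict_mono (r::nat\<Rightarrow>nat)" "((\<lambda>k. torus_proj (F k (g t))) \<circ> r) \<longlonglongrightarrow> p"
    using FB[OF t] unfolding compact_def by meson
  obtain x where x: "torus_proj x = p" using torus_proj_surj by blast
  have "torus_proj (x + (s * \<sigma>) *\<^sub>R w) \<in> B" if "s \<ge> 0" for s
  proof -
    define h where "h k = \<sigma> * (s / \<rho> k)" for k
    define E where "E k = g (t + h k) - g t - h k *\<^sub>R v" for k
    have \<rho>pos: "\<forall>\<^sub>F k in sequentially. \<rho> k > 2 * s + 1"
      using \<rho> unfolding filterlim_at_top_dense by blast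
    have inI: "\<forall>\<^sub>F k in sequentially. t + h k \<in> {0..1}"
      using \<rho>pos
    proof eventually_elim
      case (elim k)
      define u where "u = s / \<rho> k"
      have "0 \<le> u" "u \<le> 1/2" unfolding u_def using that elim by (auto simp: field_simps)
      moreover have "h k = \<sigma> * u" by (simp add: h_def u_def)
      ultimately show ?case using \<sigma> t by auto
    qed
    have h0: "h \<longlonglongrightarrow> 0"
      unfolding h_def
      by (intro tendsto_mult_right_zero tendsto_divide_0[OF tendsto_const] filterlim_at_top_imp_at_infinity \<rho>)
    have lim: "((\<lambda>k. torus_proj (F k (g (t + h k)))) \<circ> r) \<longlonglongrightarrow> torus_proj (x + (s * \<sigma>) *\<^sub>R w)"
    proof -
      have E0: "(\<lambda>k. \<rho> k * norm (E k)) \<longlonglongrightarrow> 0"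
      proof (rule tendstoI)
        fix e :: real assume "e > 0"
        define e' where "e' = e / (s + 1)"
        have e': "e' > 0" using \<open>e > 0\<close> that by (simp add: e'_def)
        have "(g has_derivative (\<lambda>y. y *\<^sub>R v)) (at t within {0..1})"
          using g' by (simp add: has_vector_derivative_def)
        then obtain d where d: "d > 0" "\<And>y. y \<in> {0..1} \<Longrightarrow> norm (y - t) < d \<Longrightarrow>
             norm (g y - g t - (y - t) *\<^sub>R v) \<le> e' * norm (y - t)"
          unfolding has_derivative_within_alt using e' by blast
        have "\<forall>\<^sub>F k in sequentially. \<bar>h k\<bar> < d"
          using h0 d(1) by (simp add: tendsto_iff)
        with inI \<rho>pos show "\<forall>\<^sub>F k in sequentially. dist (\<rho> k * norm (E k)) 0 < e"
        proof eventually_elim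
          case (elim k)
          have pos: "\<rho> k > 0" using elim that by linarith
          have "norm (E k) \<le> e' * \<bar>h k\<bar>"
            using d(2)[of "t + h k"] elim unfolding E_def by simp
          also have "\<bar>h k\<bar> = s / \<rho> k" using \<sigma> that pos by (auto simp: h_def)
          finally have "\<rho> k * norm (E k) \<le> e' * s" using pos by (simp add: field_simps)
          also have "\<dots> < e" using \<open>e > 0\<close> that by (simp add: e'_def field_simps)
          finally show ?case using pos by simp
        qed
      qed
      have FE: "(\<lambda>k. F k (E k)) \<longlonglongrightarrow> 0"
      proof (rule Lim_null_comparison)
        show "(\<lambda>k. K * (\<rho> k * norm (E k))) \<longlonglongrightarrow> 0"
          using tendsto_mult_right_zero[OF E0] .
        show "\<forall>\<^sub>F k in sequentially. norm (F k (E k)) \<le> K * (\<rho> k * norm (E k))"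
          using inI
        proof eventually_elim
          case (elim k)
          have "E k \<in> S" using S[OF elim] by (simp add: E_def)
          then show ?case using K[of "E k" k] by (simp add: F_def mult.assoc)
        qed
      qed
      have Fh: "(\<lambda>k. (\<sigma> * s) *\<^sub>R ((1 / \<rho> k) *\<^sub>R F k v)) \<longlonglongrightarrow> (\<sigma> * s) *\<^sub>R w"
        using w unfolding F_def by (intro tendsto_intros)
      have "(\<lambda>k. (\<sigma> * s) *\<^sub>R ((1 / \<rho> k) *\<^sub>R F k v) + F k (E k)) \<longlonglongrightarrow> (\<sigma> * s) *\<^sub>R w + 0"
        by (intro tendsto_add Fh FE)
      moreover have "(\<sigma> * s) *\<^sub>R ((1 / \<rho> k) *\<^sub>R F k v) + F k (E k) = F k (g (t + h k)) - F k (g t)" for k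
        unfolding E_def h_def
        by (simp add: linear_diff[OF linF] linear_scale[OF linF])
      ultimately have D: "(\<lambda>k. F k (g (t + h k)) - F k (g t)) \<longlonglongrightarrow> (s * \<sigma>) *\<^sub>R w"
        by (simp add: mult.commute)
      define D where "D k = F k (g (t + h k)) - F k (g t)" for k
      let ?T = "torus_proj (x + (s * \<sigma>) *\<^sub>R w)"
      have bd: "dist (torus_proj (F k (g (t + h k)))) ?T
          \<le> dist (torus_proj (F k (g t))) p + dist (D k) ((s * \<sigma>) *\<^sub>R w)" for k
      proof -
        have "dist (torus_proj (F k (g (t + h k)))) ?T
           \<le> dist (torus_proj (F k (g t) + D k)) (torus_proj (x + D k))
             + dist (torus_proj (x + D k)) ?T"
          unfolding D_def using dist_triangle by simp
        also have "\<dots> \<le> dist (torus_proj (F k (g t))) (torus_proj x) + dist (x + D k) (x + (s * \<sigma>) *\<^sub>R w)"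
          by (intro add_mono dist_torus_proj_translate dist_torus_le)
        finally show ?thesis by (simp add: x)
      qed
      have "(\<lambda>k. dist (torus_proj (F (r k) (g t))) p + dist (D (r k)) ((s * \<sigma>) *\<^sub>R w)) \<longlonglongrightarrow> dist p p + dist ((s * \<sigma>) *\<^sub>R w) ((s * \<sigma>) *\<^sub>R w)"
        using pr(3) LIMSEQ_subseq_LIMSEQ[OF D pr(2)] unfolding D_def o_def
        by (intro tendsto_intros)
      then have lim0: "(\<lambda>k. dist (torus_proj (F (r k) (g t))) p + dist (D (r k)) ((s * \<sigma>) *\<^sub>R w)) \<longlonglongrightarrow> 0"
        by simp
      have "((\<lambda>k. torus_proj (F k (g (t + h k)))) \<circ> r) \<longlonglongrightarrow> ?T"
        using lim0
      proof (rule metric_tendsto_imp_tendsto, intro always_eventually allI)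
        fix k
        show "dist (((\<lambda>k. torus_proj (F k (g (t + h k)))) \<circ> r) k) ?T
            \<le> dist (dist (torus_proj (F (r k) (g t))) p + dist (D (r k)) ((s * \<sigma>) *\<^sub>R w)) 0"
          using bd[of "r k"] by (simp add: dist_real_def)
      qed
      then show ?thesis .
    qed
    have "\<forall>\<^sub>F k in sequentially. ((\<lambda>k. torus_proj (F k (g (t + h k)))) \<circ> r) k \<in> B"
      using eventually_subseq[OF pr(2) inI] by eventually_elim (simp add: FB)
    then show ?thesis
      using Lim_in_closed_set[OF B(1) _ _ lim] by simp
  qed
  then show ?thesis using \<sigma>(1) by blast
qed

section \<open>Irrational rays\<close>

lemma irrational_between:
  fixes a b :: real
  assumes "a < b"
  obtains r where "a < r" "r < b" "r \<notin> \<rat>"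
proof -
  have "\<not> {a<..<b} \<subseteq> \<rat>"
    using assms countable_subset[OF _ countable_rat] uncountable_open_interval by blast
  then obtain r where "r \<in> {a<..<b}" "r \<notin> \<rat>" by blast
  then show ?thesis using that by auto
qed

text \<open>
  At the parameters \<open>s = (z\<^sub>1 - x\<^sub>1 + j) / w\<^sub>1\<close> with \<open>j\<close> an integer, the ray has first coordinate
  \<open>z\<^sub>1\<close> modulo one, and the second coordinate moves by the irrational number \<open>w\<^sub>2 / w\<^sub>1\<close> when \<open>j\<close>
  increases by one. Kronecker's theorem in dimension one finishes the argument. Taking \<open>j\<close> large, of the sign
  of \<open>w\<^sub>1\<close>, keeps \<open>s\<close> nonnegative. A quotient that is not rational has nonzero denominator, so
  \<open>w\<^sub>1 \<noteq> 0\<close> is implied.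
\<close>
lemma irrational_ray_dense:
  fixes x w :: "real ^ 2"
  assumes w: "w $ 2 / w $ 1 \<notin> \<rat>" and B: "closed B"
    and ray: "\<And>s. s \<ge> 0 \<Longrightarrow> torus_proj (x + s *\<^sub>R w) \<in> B"
  shows "B = UNIV"
proof -
  define \<theta> where "\<theta> = w $ 2 / w $ 1"
  have w1: "w $ 1 \<noteq> 0" using w by auto
  define \<sigma> :: int where "\<sigma> = (if w $ 1 > 0 then 1 else -1)"
  have \<sigma>: "\<sigma> = 1 \<or> \<sigma> = -1" "of_int \<sigma> / w $ 1 > 0" using w1 by (auto simp: \<sigma>_def)
  have irr: "of_int \<sigma> * \<theta> \<notin> \<rat>"
    using w \<sigma>(1) unfolding \<theta>_def by auto
  have "torus_proj z \<in> closure B" for z :: "real ^ 2"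
  proof -
    have "\<exists>p\<in>B. dist p (torus_proj z) < e" if e: "e > 0" for e
    proof -
      define s0 where "s0 = (z $ 1 - x $ 1) / w $ 1"
      obtain J :: nat where J: "- s0 \<le> J * (of_int \<sigma> / w $ 1)"
        using \<sigma>(2) by (meson ex_less_of_nat_mult less_imp_le)
      obtain h k where hk: "k > 0"
        "\<bar>of_int k * (of_int \<sigma> * \<theta>) - of_int h - (z $ 2 - x $ 2 - (s0 + J * (of_int \<sigma> / w $ 1)) * w $ 2)\<bar> < e"
        using sequence_of_fractional_parts_is_dense[OF irr e] .
      define s where "s = s0 + (J + of_int k) * (of_int \<sigma> / w $ 1)"
      have "s \<ge> 0"
      proof -
        have "of_int k * (of_int \<sigma> / w $ 1) \<ge> 0" using hk(1) \<sigma>(2) by (intro mult_nonneg_nonneg) auto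
        moreover have "s = s0 + J * (of_int \<sigma> / w $ 1) + of_int k * (of_int \<sigma> / w $ 1)"
          by (simp add: s_def algebra_simps add_divide_distrib)
        ultimately show ?thesis using J by linarith
      qed
      define y where "y = x + s *\<^sub>R w - vector [of_int (\<sigma> * (int J + k)), of_int h]"
      have "torus_proj y = torus_proj (x + s *\<^sub>R w)"
        by (simp add: torus_proj_eq_iff y_def forall_2)
      then have "torus_proj y \<in> B" using ray[OF \<open>s \<ge> 0\<close>] by simp
      moreover have "dist y z < e"
      proof -
        have "y $ 1 = z $ 1"
          using w1 by (simp add: y_def s_def s0_def field_simps)
        moreover have "y $ 2 - z $ 2 = of_int k * (of_int \<sigma> * \<theta>) - of_int h - (z $ 2 - x $ 2 - (s0 + J * (of_int \<sigma> / w $ 1)) * w $ 2)"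
          using w1 by (simp add: y_def s_def \<theta>_def field_simps)
        ultimately have "\<bar>y $ 1 - z $ 1\<bar> + \<bar>y $ 2 - z $ 2\<bar> < e" using hk(2) by simp
        moreover have "dist y z \<le> \<bar>y $ 1 - z $ 1\<bar> + \<bar>y $ 2 - z $ 2\<bar>"
          using norm_le_l1_cart[of "y - z"] by (simp add: dist_norm sum_2)
        ultimately show ?thesis by linarith
      qed
      ultimately show ?thesis by (meson dist_torus_le le_less_trans)
    qed
    then show ?thesis by (simp add: closure_approachable)
  qed
  then have "p \<in> B" for p
    using B torus_proj_surj[of p] by (auto simp: closure_closed)
  then show ?thesis by blast
qed

lemma no_irrational_blow_up:
  fixes A :: "int ^ 2 ^ 2" and g :: "real \<Rightarrow> real ^ 2" and \<rho> :: "nat \<Rightarrow> real"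
  assumes "expanding A" "markov_partition (toral_endomorphism A) M"
    and "\<And>s. s \<in> {0..1} \<Longrightarrow> torus_proj (g s) \<in> partition_boundary M"
    and "t \<in> {0..1}" "(g has_vector_derivative v) (at t within {0..1})"
    and "filterlim \<rho> at_top sequentially"
    and "(\<lambda>k. (1 / \<rho> k) *\<^sub>R (linear_lift A ^^ N k) v) \<longlonglongrightarrow> w"
    and "\<And>k x. x \<in> S \<Longrightarrow> norm ((linear_lift A ^^ N k) x) \<le> K * \<rho> k * norm x"
    and "\<And>s. s \<in> {0..1} \<Longrightarrow> g s - g t - (s - t) *\<^sub>R v \<in> S"
    and w: "w $ 2 / w $ 1 \<notin> \<rat>"
  shows False
proof -
  let ?B = "partition_boundary M"
  have cl: "closed ?B" by (rule closed_partition_boundary[OF assms(2)])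
  have "\<exists>x. \<exists>\<sigma>\<in>{1, -1::real}. \<forall>s\<ge>0. torus_proj (x + (s * \<sigma>) *\<^sub>R w) \<in> ?B"
    by (rule boundary_contains_ray[OF cl partition_boundary_forward_invariant[OF assms(1,2)] assms(3-9)])
  then obtain \<sigma> x where x: "\<sigma> \<in> {1, -1::real}" "\<And>s. s \<ge> 0 \<Longrightarrow> torus_proj (x + (s * \<sigma>) *\<^sub>R w) \<in> ?B"
    by blast
  have "(\<sigma> *\<^sub>R w) $ 2 / (\<sigma> *\<^sub>R w) $ 1 \<notin> \<rat>" using w x(1) by auto
  moreover have "torus_proj (x + s *\<^sub>R (\<sigma> *\<^sub>R w)) \<in> ?B" if "s \<ge> 0" for s
    using x(2)[OF that] by simp
  ultimately have "?B = UNIV" using irrational_ray_dense cl by blast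
  then show False using partition_boundary_neq_UNIV[OF assms(2)] by blast
qed

section \<open>Lifts of arcs\<close>

text \<open>
  The difference of two lifts is a continuous function with integral coordinates on a connected set.
\<close>
lemma lifts_differ_by_constant:
  fixes g h :: "real \<Rightarrow> real ^ 'n"
  assumes "continuous_on {0..1} g" "continuous_on {0..1} h"
    and "\<And>s. s \<in> {0..1} \<Longrightarrow> torus_proj (g s) = torus_proj (h s)"
  obtains k where "\<And>s. s \<in> {0..1} \<Longrightarrow> g s = h s + k"
proof -
  have "(g s - h s) $ i = (g 0 - h 0) $ i" if "s \<in> {0..1}" for s i
  proof -
    have "(\<lambda>s. (g s - h s) $ i) constant_on {0..1::real}"
    proof (rule continuous_discrete_range_constant)
      show "connected {0..1::real}" by simp
      show "continuous_on {0..1} (\<lambda>s. (g s - h s) $ i)"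
        by (intro continuous_intros assms)
      fix s :: real assume s: "s \<in> {0..1}"
      have int: "(g u - h u) $ i \<in> \<int>" if "u \<in> {0..1}" for u
        using assms(3)[OF that] by (simp add: torus_proj_eq_iff)
      have "1 \<le> norm ((g y - h y) $ i - (g s - h s) $ i)"
        if "y \<in> {0..1}" "(g y - h y) $ i \<noteq> (g s - h s) $ i" for y
      proof -
        have "(g y - h y) $ i - (g s - h s) $ i \<in> \<int>" by (intro Ints_diff int that(1) s)
        then show ?thesis using Ints_nonzero_abs_ge1[of "(g y - h y) $ i - (g s - h s) $ i"] that(2) by simp
      qed
      then show "\<exists>e>0. \<forall>y. y \<in> {0..1} \<and> (g y - h y) $ i \<noteq> (g s - h s) $ i \<longrightarrow> e \<le> norm ((g y - h y) $ i - (g s - h s) $ i)"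
        by (intro exI[of _ 1]) auto
    qed
    moreover have "(0::real) \<in> {0..1}" by simp
    ultimately show ?thesis using that unfolding constant_on_def by force
  qed
  then have "g s = h s + (g 0 - h 0)" if "s \<in> {0..1}" for s
    using that by (simp add: vec_eq_iff algebra_simps)
  then show ?thesis using that by blast
qed

text \<open>
  The derivative of a path in the torus is defined with a lift that may depend on the time; since lifts differ by
  constants, one lift serves for all times.
\<close>
lemma C1_arc_lift:
  assumes "C1_arc C"
  obtains g g' where "C = (\<lambda>s. torus_proj (g s)) ` {0..1}" "continuous_on {0..1} g'"
    "\<And>t. t \<in> {0..1} \<Longrightarrow> (g has_vector_derivative g' t) (at t within {0..1})"
    "\<And>t. t \<in> {0..1} \<Longrightarrow> g' t \<noteq> 0"
proof -
  obtain c c' where c: "C = c ` {0..1}" "continuous_on {0..1} c'"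
      "\<And>t. t \<in> {0..1} \<Longrightarrow> has_torus_derivative c (c' t) t" "\<And>t. t \<in> {0..1} \<Longrightarrow> c' t \<noteq> 0"
    using assms unfolding C1_arc_def by blast
  have "(0::real) \<in> {0..1}" by simp
  then obtain g where g: "continuous_on {0..1} g" "\<And>s. s \<in> {0..1} \<Longrightarrow> c s = torus_proj (g s)"
    using c(3) unfolding has_torus_derivative_def by metis
  have "(g has_vector_derivative c' t) (at t within {0..1})" if t: "t \<in> {0..1}" for t
  proof -
    obtain h where h: "continuous_on {0..1} h" "\<And>s. s \<in> {0..1} \<Longrightarrow> c s = torus_proj (h s)"
        "(h has_vector_derivative c' t) (at t within {0..1})"
      using c(3)[OF t] unfolding has_torus_derivative_def by metis
    obtain k where k: "\<And>s. s \<in> {0..1} \<Longrightarrow> g s = h s + k"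
      using lifts_differ_by_constant[OF g(1) h(1)] g(2) h(2) by metis
    have "((\<lambda>s. h s + k) has_vector_derivative c' t + 0) (at t within {0..1})"
      by (intro has_vector_derivative_add h(3) has_vector_derivative_const)
    then have hk: "((\<lambda>s. h s + k) has_vector_derivative c' t) (at t within {0..1})" by simp
    show ?thesis
      by (rule has_vector_derivative_transform[OF t _ hk]) (simp add: k)
  qed
  then show ?thesis using that[of g c'] c g by auto
qed

section \<open>Two-dimensional linear algebra\<close>

lemma linear_lift_2:
  fixes A :: "int ^ 2 ^ 2"
  shows "linear_lift A x $ 1 = of_int (A $ 1 $ 1) * x $ 1 + of_int (A $ 1 $ 2) * x $ 2"
    "linear_lift A x $ 2 = of_int (A $ 2 $ 1) * x $ 1 + of_int (A $ 2 $ 2) * x $ 2"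
  by (simp_all add: matrix_vector_mult_def sum_2)

text \<open>
  For a two by two matrix an eigenvector can be read off from a nonzero row of \<open>A - l\<close>.
\<close>
lemma complex_eigenvalue_2:
  fixes A :: "int ^ 2 ^ 2"
  shows "complex_eigenvalue A l \<longleftrightarrow>
    (of_int (A $ 1 $ 1) - l) * (of_int (A $ 2 $ 2) - l) = of_int (A $ 1 $ 2) * of_int (A $ 2 $ 1)"
    (is "_ \<longleftrightarrow> (?a - l) * (?d - l) = ?b * ?c")
proof -
  have "(map_matrix of_int A *v v = l *s v) \<longleftrightarrow>
      (?a - l) * v $ 1 + ?b * v $ 2 = 0 \<and> ?c * v $ 1 + (?d - l) * v $ 2 = 0" for v
    by (auto simp: matrix_vector_mult_def vec_eq_iff sum_2 forall_2 algebra_simps)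
  then have iff: "complex_eigenvalue A l \<longleftrightarrow> (\<exists>v :: complex ^ 2. v \<noteq> 0 \<and>
      (?a - l) * v $ 1 + ?b * v $ 2 = 0 \<and> ?c * v $ 1 + (?d - l) * v $ 2 = 0)"
    unfolding complex_eigenvalue_def by simp
  show ?thesis
  proof
    assume "complex_eigenvalue A l"
    then obtain v :: "complex ^ 2" where v: "v \<noteq> 0"
      "(?a - l) * v $ 1 + ?b * v $ 2 = 0" "?c * v $ 1 + (?d - l) * v $ 2 = 0"
      using iff by blast
    have "((?a - l) * (?d - l) - ?b * ?c) * v $ 1 = 0" "((?a - l) * (?d - l) - ?b * ?c) * v $ 2 = 0"
      using v(2,3) by algebra+
    moreover have "v $ 1 \<noteq> 0 \<or> v $ 2 \<noteq> 0" using v(1) by (auto simp: vec_eq_iff forall_2)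
    ultimately show "(?a - l) * (?d - l) = ?b * ?c" by auto
  next
    assume eq: "(?a - l) * (?d - l) = ?b * ?c"
    define v :: "complex ^ 2" where
      "v = (if ?b \<noteq> 0 \<or> ?a \<noteq> l then vector [?b, l - ?a]
            else if ?c \<noteq> 0 \<or> ?d \<noteq> l then vector [l - ?d, ?c] else vector [1, 0])"
    have "v \<noteq> 0" by (auto simp: v_def vec_eq_iff forall_2)
    moreover have "(?a - l) * v $ 1 + ?b * v $ 2 = 0 \<and> ?c * v $ 1 + (?d - l) * v $ 2 = 0"
      using eq by (auto simp: v_def algebra_simps)
    ultimately show "complex_eigenvalue A l" using iff by blast
  qed
qed

lemma filterlim_power_at_top:
  fixes r :: real
  assumes "r > 1" "\<And>k. N k \<ge> k"
  shows "filterlim (\<lambda>k. r ^ N k) at_top sequentially"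
proof (rule filterlim_at_top_mono)
  show "filterlim (\<lambda>k. r ^ k) at_top sequentially"
    using assms(1) by (intro filterlim_at_infinity_imp_filterlim_at_top filterlim_realpow_sequentially_gt1) auto
  show "\<forall>\<^sub>F k in sequentially. r ^ k \<le> r ^ N k"
    using assms by (intro always_eventually allI power_increasing) auto
qed

section \<open>Non-real eigenvalues\<close>

text \<open>
  Kronecker's theorem on the circle; the exponents are made to grow so that high iterates can be used.
\<close>
lemma cis_powers_dense:
  assumes "\<theta> \<notin> \<rat>" "cmod \<omega> = 1"
  obtains N :: "nat \<Rightarrow> nat" where "\<And>k. N k \<ge> k" "(\<lambda>k. cis (2 * pi * \<theta>) ^ N k) \<longlonglongrightarrow> \<omega>"
proof -
  define \<alpha> where "\<alpha> = Arg \<omega> / (2 * pi)"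
  have "\<exists>n\<ge>k. \<exists>h::int. \<bar>real n * \<theta> - of_int h - \<alpha>\<bar> < 1 / (real k + 1)" for k :: nat
  proof -
    have "1 / (real k + 1) > 0" by simp
    then obtain h m where hm: "m > 0" "\<bar>of_int m * \<theta> - of_int h - (\<alpha> - real k * \<theta>)\<bar> < 1 / (real k + 1)"
      using sequence_of_fractional_parts_is_dense[OF assms(1)] by metis
    have "real (k + nat m) * \<theta> - of_int h - \<alpha> = of_int m * \<theta> - of_int h - (\<alpha> - real k * \<theta>)"
      using hm(1) by (simp add: algebra_simps)
    then show ?thesis using hm(2) by (intro exI[of _ "k + nat m"] exI[of _ h] conjI) auto
  qed
  then obtain N h where N: "\<And>k. N k \<ge> k"
    and h: "\<And>k. \<bar>real (N k) * \<theta> - of_int (h k) - \<alpha>\<bar> < 1 / (real k + 1)"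
    by metis
  have lim: "(\<lambda>k. real (N k) * \<theta> - of_int (h k)) \<longlonglongrightarrow> \<alpha>"
  proof (rule LIM_zero_cancel, rule Lim_null_comparison)
    show "\<forall>\<^sub>F k in sequentially. norm (real (N k) * \<theta> - of_int (h k) - \<alpha>) \<le> 1 / (real k + 1)"
      using h by (intro always_eventually allI) (simp add: less_imp_le)
    show "(\<lambda>k. 1 / (real k + 1)) \<longlonglongrightarrow> 0"
      using LIMSEQ_inverse_real_of_nat by (simp add: inverse_eq_divide add.commute)
  qed
  have "(\<lambda>k. cis (2 * pi * (real (N k) * \<theta> - of_int (h k)))) \<longlonglongrightarrow> cis (2 * pi * \<alpha>)"
    unfolding cis_conv_exp by (intro tendsto_intros lim)
  moreover have "cis (2 * pi * (real (N k) * \<theta> - of_int (h k))) = cis (2 * pi * \<theta>) ^ N k" for k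
  proof -
    have "cis (2 * pi * (real (N k) * \<theta> - of_int (h k))) = cis (real (N k) * (2 * pi * \<theta>)) / cis (2 * pi * of_int (h k))"
      unfolding cis_divide by (simp add: algebra_simps)
    also have "cis (2 * pi * of_int (h k)) = 1" by (rule cis_multiple_2pi) simp
    finally show ?thesis by (simp add: Complex.DeMoivre)
  qed
  moreover have "\<omega> \<noteq> 0" using assms(2) by auto
  then have "cis (2 * pi * \<alpha>) = \<omega>"
    using assms(2) cis_Arg[of \<omega>] by (auto simp: \<alpha>_def sgn_div_norm)
  ultimately have "(\<lambda>k. cis (2 * pi * \<theta>) ^ N k) \<longlonglongrightarrow> \<omega>" by simp
  then show ?thesis using that N by blast
qed

text \<open>
  The left eigenvector for \<open>l\<close> is a real-linear isomorphism \<open>\<psi>\<close> from the plane to \<open>\<complex>\<close> with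
  \<open>\<psi> (A x) = l \<psi> x\<close>. So the direction of \<open>A\<^sup>n v\<close> turns by \<open>arg l\<close> in each step, all directions are
  limits, and a limit direction of irrational slope exists.
\<close>
lemma nonreal_eigenvalue_nowhere_differentiable:
  fixes A :: "int ^ 2 ^ 2"
  assumes "expanding A" "markov_partition (toral_endomorphism A) M"
    and l: "complex_eigenvalue A l" "l \<notin> \<real>" "\<not> (\<exists>q\<in>\<rat>. Arg l = q * pi)"
  shows "nowhere_differentiable M"
proof -
  define a b c d where abcd: "a = A $ 1 $ 1" "b = A $ 1 $ 2" "c = A $ 2 $ 1" "d = A $ 2 $ 2"
  have char: "(of_int a - l) * (of_int d - l) = of_int b * of_int c"
    using l(1) unfolding complex_eigenvalue_2 abcd .
  have Im: "Im l \<noteq> 0" using l(2) by (simp add: complex_is_Real_iff)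
  have "c \<noteq> 0"
  proof
    assume "c = 0"
    then have "l = of_int a \<or> l = of_int d" using char by auto
    then show False using l(2) by auto
  qed
  have l1: "cmod l > 1" using assms(1) l(1) by (simp add: expanding_def)
  define \<psi> :: "real ^ 2 \<Rightarrow> complex" where "\<psi> x = of_int c * of_real (x $ 1) + (l - of_int a) * of_real (x $ 2)" for x
  define \<xi> :: "complex \<Rightarrow> real ^ 2" where
    "\<xi> z = vector [(Re z - (Re l - of_int a) * (Im z / Im l)) / of_int c, Im z / Im l]" for z
  have \<xi>\<psi>: "\<xi> (\<psi> x) = x" for x
    using Im \<open>c \<noteq> 0\<close> by (simp add: \<xi>_def \<psi>_def vec_eq_iff forall_2 field_simps)
  have \<psi>\<xi>: "\<psi> (\<xi> z) = z" for z
    using Im \<open>c \<noteq> 0\<close> by (simp add: \<xi>_def \<psi>_def complex_eq_iff field_simps)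
  have \<psi>A: "\<psi> (linear_lift A x) = l * \<psi> x" for x
  proof -
    have "\<psi> (linear_lift A x) - l * \<psi> x = - ((of_int a - l) * (of_int d - l) - of_int b * of_int c) * of_real (x $ 2)"
      unfolding \<psi>_def linear_lift_2 abcd[symmetric] by (simp add: algebra_simps)
    then show ?thesis using char by simp
  qed
  have \<psi>An: "\<psi> ((linear_lift A ^^ n) x) = l ^ n * \<psi> x" for n x
    by (induction n) (simp_all add: \<psi>A)
  have lin\<xi>: "linear \<xi>"
    by (rule linearI) (simp_all add: \<xi>_def vec_eq_iff forall_2 algebra_simps add_divide_distrib diff_divide_distrib)
  have lin\<psi>: "linear \<psi>"
    by (rule linearI) (simp_all add: \<psi>_def complex_eq_iff algebra_simps)
  obtain K1 where K1: "K1 > 0" "\<And>z. norm (\<xi> z) \<le> K1 * norm z"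
    using linear_bounded_pos[OF lin\<xi>] by blast
  obtain K2 where K2: "K2 > 0" "\<And>z. norm (\<psi> z) \<le> K2 * norm z"
    using linear_bounded_pos[OF lin\<psi>] by blast
  have An: "(linear_lift A ^^ n) x = \<xi> (l ^ n * \<psi> x)" for n x
    using \<xi>\<psi>[of "(linear_lift A ^^ n) x"] by (simp add: \<psi>An)
  have bound: "norm ((linear_lift A ^^ n) x) \<le> K1 * K2 * cmod l ^ n * norm x" for n x
  proof -
    have "norm ((linear_lift A ^^ n) x) \<le> K1 * (cmod l ^ n * norm (\<psi> x))"
      unfolding An using K1(2)[of "l ^ n * \<psi> x"] by (simp add: norm_mult norm_power)
    also have "\<dots> \<le> K1 * (cmod l ^ n * (K2 * norm x))"
      using K1 K2 by (intro mult_left_mono) auto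
    finally show ?thesis by (simp add: mult_ac)
  qed
  define \<theta> where "\<theta> = Arg l / (2 * pi)"
  have \<theta>: "\<theta> \<notin> \<rat>"
  proof
    assume "\<theta> \<in> \<rat>"
    then have "2 * \<theta> \<in> \<rat>" by simp
    moreover have "Arg l = (2 * \<theta>) * pi" by (simp add: \<theta>_def)
    ultimately show False using l(3) by blast
  qed
  have False if g: "\<And>s. s \<in> {0..1} \<Longrightarrow> torus_proj (g s) \<in> partition_boundary M"
      and t: "t \<in> {0..1}" and g': "(g has_vector_derivative v) (at t within {0..1})" and v: "v \<noteq> 0" for g t v
  proof -
    obtain r :: real where r: "r \<notin> \<rat>" using irrational_between[of 0 1] by auto
    define w0 :: "real ^ 2" where "w0 = vector [1, r]"
    have "w0 \<noteq> 0" by (simp add: w0_def vec_eq_iff forall_2)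
    have \<psi>0: "\<psi> x \<noteq> 0" if "x \<noteq> 0" for x
    proof
      assume "\<psi> x = 0"
      then have "x = \<xi> 0" using \<xi>\<psi>[of x] by simp
      then show False using that linear_0[OF lin\<xi>] by simp
    qed
    \<comment> \<open>The scaling puts \<open>\<psi> w\<close> on the circle through \<open>\<psi> v\<close>, so that a rotation takes one to the other.\<close>
    define \<tau> where "\<tau> = cmod (\<psi> v) / cmod (\<psi> w0)"
    have \<tau>: "\<tau> > 0" using \<psi>0 v \<open>w0 \<noteq> 0\<close> by (simp add: \<tau>_def)
    define w where "w = \<tau> *\<^sub>R w0"
    define \<omega> where "\<omega> = \<psi> w / \<psi> v"
    have "cmod \<omega> = 1"
      using \<psi>0[OF v] \<psi>0[OF \<open>w0 \<noteq> 0\<close>] \<tau>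
      by (simp add: \<omega>_def w_def linear_scale[OF lin\<psi>] norm_divide \<tau>_def)
    then obtain N where N: "\<And>k. N k \<ge> k" "(\<lambda>k. cis (2 * pi * \<theta>) ^ N k) \<longlonglongrightarrow> \<omega>"
      using cis_powers_dense[OF \<theta>] by blast
    have lpol: "l ^ n = of_real (cmod l ^ n) * cis (2 * pi * \<theta>) ^ n" for n
    proof -
      have "l \<noteq> 0" using l1 by auto
      then have "cis (2 * pi * \<theta>) = sgn l"
        using cis_Arg[of l] by (auto simp: \<theta>_def)
      then have "l = of_real (cmod l) * cis (2 * pi * \<theta>)"
        using \<open>l \<noteq> 0\<close> by (simp add: sgn_eq)
      then show ?thesis by (metis power_mult_distrib of_real_power)
    qed
    have "(\<lambda>k. \<xi> (cis (2 * pi * \<theta>) ^ N k * \<psi> v)) \<longlonglongrightarrow> \<xi> (\<omega> * \<psi> v)"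
      using linear_conv_bounded_linear lin\<xi>
      by (intro bounded_linear.tendsto[where f = \<xi>] tendsto_mult N(2) tendsto_const) blast
    moreover have "\<xi> (\<omega> * \<psi> v) = w" using \<psi>0[OF v] \<xi>\<psi> by (simp add: \<omega>_def)
    moreover have "\<xi> (cis (2 * pi * \<theta>) ^ N k * \<psi> v) = (1 / cmod l ^ N k) *\<^sub>R (linear_lift A ^^ N k) v" for k
    proof -
      have "l \<noteq> 0" using l1 by auto
      then have "cis (2 * pi * \<theta>) ^ N k * \<psi> v = (1 / cmod l ^ N k) *\<^sub>R (l ^ N k * \<psi> v)"
        unfolding lpol by (simp add: scaleR_conv_of_real)
      then show ?thesis unfolding An by (simp only: linear_scale[OF lin\<xi>])
    qed
    ultimately have lim: "(\<lambda>k. (1 / cmod l ^ N k) *\<^sub>R (linear_lift A ^^ N k) v) \<longlonglongrightarrow> w" by simp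
    have "w $ 2 / w $ 1 \<notin> \<rat>"
      using \<tau> r by (simp add: w_def w0_def)
    then show False
      using no_irrational_blow_up[OF assms(1,2) g t g' filterlim_power_at_top[OF l1 N(1)] lim, where S = UNIV and K = "K1 * K2"]
        bound by simp
  qed
  note no_deriv = this
  show ?thesis
    unfolding nowhere_differentiable_def
  proof (intro allI impI ballI)
    fix \<gamma> :: "real \<Rightarrow> 2 torus" and t :: real
    assume \<gamma>: "continuous_on {0..1} \<gamma> \<and> inj_on \<gamma> {0..1} \<and> \<gamma> ` {0..1} \<subseteq> partition_boundary M"
      and t: "t \<in> {0..1}"
    have "v = 0" if deriv: "has_torus_derivative \<gamma> v t" for v
    proof (rule ccontr)
      assume "v \<noteq> 0"
      obtain g where g: "\<And>s. s \<in> {0..1} \<Longrightarrow> \<gamma> s = torus_proj (g s)"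
          "(g has_vector_derivative v) (at t within {0..1})"
        using deriv unfolding has_torus_derivative_def by blast
      have "torus_proj (g s) \<in> partition_boundary M" if "s \<in> {0..1}" for s
        using \<gamma> that by (auto simp: g(1)[OF that, symmetric])
      then show False using no_deriv[OF _ t g(2) \<open>v \<noteq> 0\<close>] by blast
    qed
    then show "\<not> (\<exists>v. has_torus_derivative \<gamma> v t) \<or> has_torus_derivative \<gamma> 0 t" by blast
  qed
qed

section \<open>Real irrational eigenvalues\<close>

text \<open>
  Write \<open>x = P x u\<^sub>l + Q x u\<^sub>m\<close> with eigenvectors for \<open>l\<close> and \<open>m\<close>. If some tangent \<open>v\<close> of the arc has
  \<open>Q v \<noteq> 0\<close>, then \<open>A\<^sup>2\<^sup>k v / m\<^sup>2\<^sup>k\<close> converges to \<open>Q v u\<^sub>m\<close>. Otherwise \<open>Q\<close> is constant on the arc, the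
  arc lies on a line with direction \<open>u\<^sub>l\<close>, and \<open>A\<^sup>2\<^sup>k\<close> is multiplication by \<open>l\<^sup>2\<^sup>k\<close> along that line. Even
  powers are used to make the scales positive. The slopes are irrational since the entries of \<open>A\<close> are
  rational and \<open>l\<close>, \<open>m\<close> are not.
\<close>
lemma irrational_eigenvalues_essentially_nowhere_smooth:
  fixes A :: "int ^ 2 ^ 2" and l m :: real
  assumes "expanding A" "markov_partition (toral_endomorphism A) M"
    and l: "complex_eigenvalue A (of_real l)" "l \<notin> \<rat>"
    and m: "complex_eigenvalue A (of_real m)" "m \<notin> \<rat>"
    and less: "\<bar>l\<bar> < \<bar>m\<bar>"
  shows "essentially_nowhere_smooth M"
proof -
  define a b c d where abcd: "a = real_of_int (A $ 1 $ 1)" "b = real_of_int (A $ 1 $ 2)"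
    "c = real_of_int (A $ 2 $ 1)" "d = real_of_int (A $ 2 $ 2)"
  have rat: "a \<in> \<rat>" "b \<in> \<rat>" "c \<in> \<rat>" "d \<in> \<rat>" by (simp_all add: abcd)
  have "complex_of_real ((a - k) * (d - k)) = complex_of_real (b * c)"
    if "complex_eigenvalue A (of_real k)" for k
    using that unfolding complex_eigenvalue_2 abcd by simp
  then have char: "(a - k) * (d - k) = b * c" if "complex_eigenvalue A (of_real k)" for k
    using that of_real_eq_iff by blast
  note cl = char[OF l(1)] and cm = char[OF m(1)]
  have l1: "\<bar>l\<bar> > 1" using assms(1) l(1) unfolding expanding_def by fastforce
  have "m \<noteq> l" using less by auto
  have "c \<noteq> 0"
  proof
    assume "c = 0"
    then have "l = a \<or> l = d" using cl by auto
    then show False using l(2) rat by auto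
  qed
  define u :: "real \<Rightarrow> real ^ 2" where "u k = vector [k - d, c]" for k
  have Au: "linear_lift A (u k) = k *\<^sub>R u k" if "(a - k) * (d - k) = b * c" for k
    using that by (simp add: vec_eq_iff forall_2 linear_lift_2 u_def abcd[symmetric] algebra_simps)
  have Anu: "(linear_lift A ^^ n) (u k) = k ^ n *\<^sub>R u k" if "(a - k) * (d - k) = b * c" for n k
    by (induction n) (simp_all add: Au[OF that] matrix_vector_mult_scaleR)
  define P Q :: "real ^ 2 \<Rightarrow> real" where "P x = (x $ 1 - (m - d) * x $ 2 / c) / (l - m)"
    and "Q x = (x $ 1 - (l - d) * x $ 2 / c) / (m - l)" for x
  have linPQ: "linear P" "linear Q"
    by (rule linearI; simp add: P_def Q_def algebra_simps add_divide_distrib diff_divide_distrib)+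
  have dec: "x = P x *\<^sub>R u l + Q x *\<^sub>R u m" for x
  proof -
    have "(P x *\<^sub>R u l + Q x *\<^sub>R u m) $ 2 = x $ 2"
    proof -
      have "P x + Q x = x $ 2 / c"
        using \<open>m \<noteq> l\<close> \<open>c \<noteq> 0\<close> by (simp add: P_def Q_def divide_simps) (simp add: algebra_simps)
      then have "(P x + Q x) * c = x $ 2" using \<open>c \<noteq> 0\<close> by simp
      then show ?thesis by (simp add: u_def algebra_simps)
    qed
    moreover have "(P x *\<^sub>R u l + Q x *\<^sub>R u m) $ 1 = x $ 1"
      using \<open>m \<noteq> l\<close> \<open>c \<noteq> 0\<close> by (simp add: P_def Q_def u_def divide_simps) (simp add: algebra_simps)
    ultimately show ?thesis by (simp add: vec_eq_iff forall_2)
  qed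
  have An: "(linear_lift A ^^ n) x = (P x * l ^ n) *\<^sub>R u l + (Q x * m ^ n) *\<^sub>R u m" for n x
    using linear_lift_funpow_linear[of n A] Anu[OF cl, of n] Anu[OF cm, of n]
    by (subst dec[of x]) (simp add: linear_add linear_scale)
  have slope: "(r *\<^sub>R u k) $ 2 / (r *\<^sub>R u k) $ 1 \<notin> \<rat>" if "k \<notin> \<rat>" "r \<noteq> 0" for k r
  proof
    assume "(r *\<^sub>R u k) $ 2 / (r *\<^sub>R u k) $ 1 \<in> \<rat>"
    then have "c / (k - d) \<in> \<rat>" using that(2) by (simp add: u_def)
    then have "c / (c / (k - d)) + d \<in> \<rat>" using Rats_add[OF Rats_divide[OF rat(3)] rat(4)] by blast
    moreover have "k \<noteq> d" using that rat by auto
    ultimately show False using that \<open>c \<noteq> 0\<close> by simp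
  qed
  have pow: "filterlim (\<lambda>n. k ^ (2 * n)) at_top sequentially" if "\<bar>k\<bar> > 1" for k :: real
  proof -
    have "\<bar>k\<bar> ^ (2 * n) = k ^ (2 * n)" for n by (simp add: power_even_abs)
    then show ?thesis using filterlim_power_at_top[of "\<bar>k\<bar>" "\<lambda>n. 2 * n"] that by simp
  qed
  show ?thesis
    unfolding essentially_nowhere_smooth_def
  proof (rule notI, elim exE conjE)
    fix C assume C: "C1_arc C" "C \<subseteq> partition_boundary M"
    obtain g g' where g: "C = (\<lambda>s. torus_proj (g s)) ` {0..1}"
      "\<And>t. t \<in> {0..1} \<Longrightarrow> (g has_vector_derivative g' t) (at t within {0..1})"
      "\<And>t. t \<in> {0..1} \<Longrightarrow> g' t \<noteq> 0"
      using C1_arc_lift[OF C(1)] by metis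
    have gB: "torus_proj (g s) \<in> partition_boundary M" if "s \<in> {0..1}" for s
      using that g(1) C(2) by blast
    show False
    proof (cases "\<exists>t\<in>{0..1}. Q (g' t) \<noteq> 0")
      case True
      then obtain t where t: "t \<in> {0..1}" "Q (g' t) \<noteq> 0" by blast
      have m1: "\<bar>m\<bar> > 1" using l1 less by linarith
      have "(\<lambda>k. (P (g' t) * ((l / m)\<^sup>2) ^ k) *\<^sub>R u l + Q (g' t) *\<^sub>R u m) \<longlonglongrightarrow> (P (g' t) * 0) *\<^sub>R u l + Q (g' t) *\<^sub>R u m"
      proof (intro tendsto_intros LIMSEQ_power_zero)
        have "\<bar>l / m\<bar> < 1" using less by (simp add: field_simps)
        then show "norm ((l / m)\<^sup>2) < 1" by (simp add: abs_square_less_1)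
      qed
      moreover have "(1 / m ^ (2 * k)) *\<^sub>R (linear_lift A ^^ (2 * k)) (g' t) = (P (g' t) * ((l / m)\<^sup>2) ^ k) *\<^sub>R u l + Q (g' t) *\<^sub>R u m" for k
        using m1 unfolding An by (simp add: scaleR_add_right power_mult power_divide)
      ultimately have lim: "(\<lambda>k. (1 / m ^ (2 * k)) *\<^sub>R (linear_lift A ^^ (2 * k)) (g' t)) \<longlonglongrightarrow> Q (g' t) *\<^sub>R u m"
        by simp
      obtain KP where KP: "KP > 0" "\<And>x. norm (P x) \<le> KP * norm x"
        using linear_bounded_pos[OF linPQ(1)] by blast
      obtain KQ where KQ: "KQ > 0" "\<And>x. norm (Q x) \<le> KQ * norm x"
        using linear_bounded_pos[OF linPQ(2)] by blast
      have bound: "norm ((linear_lift A ^^ (2 * k)) x) \<le> (KP * norm (u l) + KQ * norm (u m)) * m ^ (2 * k) * norm x" for k x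
      proof -
        have lm: "l ^ (2 * k) \<le> m ^ (2 * k)"
          using power_mono[of "\<bar>l\<bar>" "\<bar>m\<bar>" "2 * k"] less by (simp add: power_even_abs)
        have "norm ((linear_lift A ^^ (2 * k)) x) \<le> norm ((P x * l ^ (2 * k)) *\<^sub>R u l) + norm ((Q x * m ^ (2 * k)) *\<^sub>R u m)"
          unfolding An by (rule norm_triangle_ineq)
        also have "\<dots> = \<bar>P x\<bar> * l ^ (2 * k) * norm (u l) + \<bar>Q x\<bar> * m ^ (2 * k) * norm (u m)"
          by (simp add: abs_mult)
        also have "\<dots> \<le> (KP * norm x) * m ^ (2 * k) * norm (u l) + (KQ * norm x) * m ^ (2 * k) * norm (u m)"
          using KP KQ lm by (intro add_mono mult_mono) (auto simp: zero_le_even_power)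
        finally show ?thesis by (simp add: algebra_simps)
      qed
      show False
        by (rule no_irrational_blow_up[OF assms(1,2) gB t(1) g(2)[OF t(1)] pow[OF m1] lim bound _ slope[OF m(2) t(2)], where S = UNIV]) auto
    next
      case False
      then have Q0: "Q (g' t) = 0" if "t \<in> {0..1}" for t using that by blast
      have bl: "bounded_linear Q" using linPQ(2) linear_conv_bounded_linear by blast
      have dQ: "((\<lambda>s. Q (g s)) has_vector_derivative 0) (at t within {0..1})" if "t \<in> {0..1}" for t
        using bounded_linear.has_vector_derivative[OF bl g(2)[OF that]] Q0[OF that] by simp
      obtain q where "\<And>s. s \<in> {0..1} \<Longrightarrow> Q (g s) = q"
        using has_vector_derivative_zero_constant[OF _ dQ] by (metis convex_real_interval(5))
      then have Qc: "Q (g s) = Q (g 0)" if "s \<in> {0..1}" for s using that by simp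
      have t: "(0::real) \<in> {0..1}" by simp
      define v where "v = g' 0"
      have v: "v = P v *\<^sub>R u l" "P v \<noteq> 0"
        using dec[of v] Q0[OF t] g(3)[OF t] by (auto simp: v_def)
      have lim: "(\<lambda>k. (1 / l ^ (2 * k)) *\<^sub>R (linear_lift A ^^ (2 * k)) v) \<longlonglongrightarrow> P v *\<^sub>R u l"
      proof -
        have "(1 / l ^ (2 * k)) *\<^sub>R (linear_lift A ^^ (2 * k)) v = P v *\<^sub>R u l" for k
          using l1 Q0[OF t] unfolding An by (simp add: v_def)
        then show ?thesis by simp
      qed
      have bound: "norm ((linear_lift A ^^ (2 * k)) x) \<le> 1 * l ^ (2 * k) * norm x" if "x \<in> {x. Q x = 0}" for k x
      proof -
        have x: "x = P x *\<^sub>R u l" using dec[of x] that by simp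
        have "(linear_lift A ^^ (2 * k)) x = l ^ (2 * k) *\<^sub>R x"
          unfolding An using that by (subst (2) x) simp
        then show ?thesis by simp
      qed
      have S: "g s - g 0 - (s - 0) *\<^sub>R v \<in> {x. Q x = 0}" if "s \<in> {0..1}" for s
        using Qc[OF that] Q0[OF t] linPQ(2) by (simp add: linear_diff linear_scale v_def)
      show False
        by (rule no_irrational_blow_up[OF assms(1,2) gB t g(2)[OF t, folded v_def] pow[OF l1] lim bound S slope[OF l(2) v(2)]])
    qed
  qed
qed

section \<open>Non-diagonalizable matrices\<close>

lemma complex_diagonalizableI:
  fixes P D :: "complex ^ 'n ^ 'n"
  assumes P: "invertible P" and D: "\<And>i j. i \<noteq> j \<Longrightarrow> D $ i $ j = 0"
    and eq: "map_matrix of_int A ** P = P ** D"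
  shows "complex_diagonalizable A"
proof -
  have inv: "P ** matrix_inv P = mat 1"
    using P unfolding invertible_def matrix_inv_def by (metis (mono_tags, lifting) someI_ex)
  have "map_matrix of_int A = map_matrix of_int A ** P ** matrix_inv P"
    by (simp add: matrix_mul_assoc[symmetric] inv)
  also have "\<dots> = P ** D ** matrix_inv P" by (simp only: eq)
  finally show ?thesis
    unfolding complex_diagonalizable_def using P D by (intro exI[of _ P] exI[of _ D]) simp
qed

lemma diagonal_imp_complex_diagonalizable:
  fixes A :: "int ^ 2 ^ 2"
  assumes "A $ 1 $ 2 = 0" "A $ 2 $ 1 = 0"
  shows "complex_diagonalizable A"
proof (rule complex_diagonalizableI)
  show "invertible (mat 1 :: complex ^ 2 ^ 2)" by (simp add: invertible_det_nz)
  show "map_matrix of_int A ** mat 1 = mat 1 ** (map_matrix of_int A :: complex ^ 2 ^ 2)" by simp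
  show "map_matrix of_int A $ i $ j = (0::complex)" if "i \<noteq> j" for i j
    using that assms exhaust_2[of i] exhaust_2[of j] by auto
qed

text \<open>
  There are two different eigenvalues, and the matrix of their eigenvectors is invertible.
\<close>
lemma nonzero_discriminant_imp_complex_diagonalizable:
  fixes A :: "int ^ 2 ^ 2"
  assumes "(A $ 1 $ 1 - A $ 2 $ 2)\<^sup>2 + 4 * A $ 1 $ 2 * A $ 2 $ 1 \<noteq> 0"
  shows "complex_diagonalizable A"
proof (cases "A $ 1 $ 2 = 0 \<and> A $ 2 $ 1 = 0")
  case True
  then show ?thesis by (simp add: diagonal_imp_complex_diagonalizable)
next
  case False
  define a b c d :: complex where abcd: "a = of_int (A $ 1 $ 1)" "b = of_int (A $ 1 $ 2)"
    "c = of_int (A $ 2 $ 1)" "d = of_int (A $ 2 $ 2)"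
  define r where "r = csqrt ((a - d)\<^sup>2 + 4 * b * c)"
  have r2: "r\<^sup>2 = (a - d)\<^sup>2 + 4 * b * c" by (simp add: r_def)
  have "(a - d)\<^sup>2 + 4 * b * c = of_int ((A $ 1 $ 1 - A $ 2 $ 2)\<^sup>2 + 4 * A $ 1 $ 2 * A $ 2 $ 1)"
    by (simp add: abcd)
  then have "r \<noteq> 0" using assms r2 by (metis of_int_eq_0_iff zero_power2)
  define l m where "l = (a + d + r) / 2" and "m = (a + d - r) / 2"
  have lm: "l - m = r" by (simp add: l_def m_def field_simps)
  have l: "(a - l) * (d - l) = b * c" and m: "(a - m) * (d - m) = b * c"
    using r2 by (simp_all add: l_def m_def field_simps power2_eq_square)
  define P D :: "complex ^ 2 ^ 2" where
    "P = (if b \<noteq> 0 then vector [vector [b, b], vector [l - a, m - a]]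
          else vector [vector [l - d, m - d], vector [c, c]])"
    and "D = vector [vector [l, 0], vector [0, m]]"
  show ?thesis
  proof (rule complex_diagonalizableI)
    show "invertible P"
    proof -
      have "c \<noteq> 0" if "b = 0" using False that by (simp add: abcd)
      moreover have "l \<noteq> m" using lm \<open>r \<noteq> 0\<close> by auto
      ultimately show ?thesis unfolding invertible_det_nz det_2 P_def by (auto simp: algebra_simps)
    qed
    show "D $ i $ j = 0" if "i \<noteq> j" for i j
      using that exhaust_2[of i] exhaust_2[of j] by (auto simp: D_def)
    have entries: "c * b + d * (k - a) = (k - a) * k" "b = 0 \<Longrightarrow> a * (k - d) = (k - d) * k"
      if "(a - k) * (d - k) = b * c" for k
      using that by algebra+
    show "map_matrix of_int A ** P = P ** D"
      using entries[OF l] entries[OF m]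
      by (simp add: matrix_matrix_mult_def vec_eq_iff forall_2 sum_2 P_def D_def abcd[symmetric])
        (simp add: algebra_simps)
  qed
qed

text \<open>
  The discriminant vanishes, so \<open>L\<close>, the double root of the characteristic polynomial, is half the
  trace. The trace is even because \<open>(a - d)\<^sup>2 = - 4 b c\<close>. The matrix \<open>A - L\<close> is nilpotent of rank one:
  its image and its kernel are both spanned by an integral vector \<open>e\<close>, and the linear forms that
  vanish on \<open>e\<close> are the multiples of \<open>det (e, x)\<close>.
\<close>
lemma nondiagonalizable_shear_form:
  fixes A :: "int ^ 2 ^ 2"
  assumes "expanding A" "\<not> complex_diagonalizable A"
  shows "\<exists>(L :: int) (e :: real ^ 2) \<kappa>. \<bar>L\<bar> \<ge> 2 \<and> (\<forall>i. e $ i \<in> \<int>) \<and> e \<noteq> 0 \<and> \<kappa> \<noteq> 0 \<and>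
    (\<forall>x. linear_lift A x = of_int L *\<^sub>R x + (\<kappa> * (e $ 1 * x $ 2 - e $ 2 * x $ 1)) *\<^sub>R e)"
proof -
  define a b c d where abcd: "a = A $ 1 $ 1" "b = A $ 1 $ 2" "c = A $ 2 $ 1" "d = A $ 2 $ 2"
  have bc: "b \<noteq> 0 \<or> c \<noteq> 0"
    using assms(2) diagonal_imp_complex_diagonalizable[of A] by (auto simp: abcd)
  have disc: "(a - d)\<^sup>2 + 4 * b * c = 0"
    using assms(2) nonzero_discriminant_imp_complex_diagonalizable[of A] by (auto simp: abcd)
  then have "(a - d)\<^sup>2 = 2 * (- 2 * b * c)" by simp
  then have "even ((a - d)\<^sup>2)" by (metis dvd_triv_left)
  then have "even (a - d)" by simp
  then obtain p where p: "a - d = 2 * p" by blast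
  define L where "L = d + p"
  have aL: "a = L + p" "d = L - p" using p by (simp_all add: L_def)
  have p2: "p * p = - (b * c)" using disc p by (simp add: power2_eq_square)
  have "(a - L) * (d - L) = b * c" using p2 aL by simp
  then have "complex_of_int ((a - L) * (d - L)) = of_int (b * c)" by (simp only:)
  then have "complex_eigenvalue A (of_int L)"
    unfolding complex_eigenvalue_2 abcd[symmetric] by simp
  then have "cmod (of_int L) > 1" using assms(1) unfolding expanding_def by blast
  then have "real_of_int \<bar>L\<bar> > 1" by simp
  then have L: "\<bar>L\<bar> \<ge> 2" by linarith
  have p2r: "real_of_int p * of_int p = - (of_int b * of_int c)"
    using p2 by (metis of_int_minus of_int_mult)
  show ?thesis
  proof (cases "b = 0")
    case False
    define e :: "real ^ 2" where "e = vector [of_int b, - of_int p]"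
    have "linear_lift A x = of_int L *\<^sub>R x + (1 / of_int b * (e $ 1 * x $ 2 - e $ 2 * x $ 1)) *\<^sub>R e" for x
    proof -
      have "of_int b * (of_int c * x $ 1) = - (of_int p * (of_int p * x $ 1))"
        using arg_cong[OF p2r, of "\<lambda>t. - t * x $ 1"] by (simp add: mult_ac)
      then show ?thesis
        using False by (simp add: e_def vec_eq_iff forall_2 linear_lift_2 abcd[symmetric] aL field_simps)
    qed
    moreover have "e $ i \<in> \<int>" for i using exhaust_2[of i] by (auto simp: e_def)
    moreover have "e \<noteq> 0" using False by (auto simp: e_def vec_eq_iff forall_2)
    moreover have "(1 / of_int b :: real) \<noteq> 0" using False by simp
    ultimately show ?thesis using L by blast
  next
    case True
    then have "c \<noteq> 0" "p = 0" using bc p2 by auto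
    define e :: "real ^ 2" where "e = vector [0, 1]"
    have "linear_lift A x = of_int L *\<^sub>R x + (- of_int c * (e $ 1 * x $ 2 - e $ 2 * x $ 1)) *\<^sub>R e" for x
      using True \<open>p = 0\<close>
      by (simp add: e_def vec_eq_iff forall_2 linear_lift_2 abcd[symmetric] aL)
    moreover have "e $ i \<in> \<int>" for i using exhaust_2[of i] by (auto simp: e_def)
    moreover have "e \<noteq> 0" by (auto simp: e_def vec_eq_iff forall_2)
    moreover have "(- of_int c :: real) \<noteq> 0" using \<open>c \<noteq> 0\<close> by simp
    ultimately show ?thesis using L by blast
  qed
qed

text \<open>
  The intermediate value theorem for values on the circle: a function that changes by at least one takes every
  value modulo one.
\<close>
lemma continuous_hits_integer_translate:
  fixes u :: "real \<Rightarrow> real"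
  assumes "x \<le> y" "continuous_on {x..y} u" "\<bar>u y - u x\<bar> \<ge> 1"
  shows "\<exists>s\<in>{x..y}. \<exists>i::int. u s = a + of_int i"
proof -
  define i where "i = \<lceil>min (u x) (u y) - a\<rceil>"
  have i: "min (u x) (u y) \<le> a + of_int i" "a + of_int i \<le> max (u x) (u y)"
    using assms(3) unfolding i_def by linarith+
  show ?thesis
  proof (cases "u x \<le> u y")
    case True
    then show ?thesis using IVT'[of u x "a + of_int i" y] i assms(1,2) by auto
  next
    case False
    then show ?thesis using IVT2'[of u y "a + of_int i" x] i assms(1,2) by auto
  qed
qed

text \<open>
  By the mean value theorem. The bound is on the absolute value of the derivative, so that it can be used for
  coordinates whose direction of motion depends on the signs of \<open>L\<close>, \<open>m\<close> and the derivative of \<open>\<beta>\<close>.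
\<close>
lemma derivative_lower_bound_increment:
  fixes u u' :: "real \<Rightarrow> real"
  assumes "x < y" "\<And>s. s \<in> {x..y} \<Longrightarrow> (u has_real_derivative u' s) (at s within {x..y})"
    and "\<And>s. s \<in> {x..y} \<Longrightarrow> \<bar>u' s\<bar> \<ge> k" "k * (y - x) \<ge> 1"
  shows "\<bar>u y - u x\<bar> \<ge> 1"
proof -
  have D: "(u has_derivative (*) (u' s)) (at s within {x..y})" if "x \<le> s" "s \<le> y" for s
    using assms(2)[of s] that by (simp add: has_field_derivative_def)
  obtain s where s: "s \<in> {x<..<y}" "u y - u x = u' s * (y - x)"
    using mvt_simple[OF assms(1) D] by blast
  have "k * (y - x) \<le> \<bar>u' s\<bar> * (y - x)"
    using assms(3)[of s] s(1) assms(1) by (intro mult_right_mono) auto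
  also have "\<dots> = \<bar>u y - u x\<bar>" using s(2) assms(1) by (simp add: abs_mult)
  finally show ?thesis using assms(4) by linarith
qed

text \<open>
  The functions \<open>\<alpha>\<close> and \<open>\<beta>\<close> are the coordinates of a curve along and across the eigendirection, and the terms
  on the right are the coordinates of its image under \<open>A\<^sup>n\<close>. Near \<open>t\<^sub>0\<close> the second coordinate
  of the image moves at speed between \<open>\<delta> \<bar>L\<bar>\<^sup>n\<close> and \<open>3 \<delta> \<bar>L\<bar>\<^sup>n\<close>, so it takes the value \<open>b\<close> modulo one. The
  first coordinate moves about \<open>n\<close> times faster, so shortly afterwards it takes the value \<open>a\<close> modulo
  one, and until then the second coordinate has changed only by a quantity of order \<open>1 / n\<close>.
\<close>
lemma sheared_curve_dense:
  fixes \<alpha> \<beta> \<alpha>' \<beta>' :: "real \<Rightarrow> real" and L m a b e :: real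
  assumes \<alpha>: "\<And>t. t \<in> {0..1} \<Longrightarrow> (\<alpha> has_real_derivative \<alpha>' t) (at t within {0..1})"
    and \<beta>: "\<And>t. t \<in> {0..1} \<Longrightarrow> (\<beta> has_real_derivative \<beta>' t) (at t within {0..1})"
    and cont: "continuous_on {0..1} \<alpha>'" "continuous_on {0..1} \<beta>'"
    and t0: "t0 \<in> {0..1}" "\<beta>' t0 \<noteq> 0" and L: "\<bar>L\<bar> > 1" and "m \<noteq> 0" "e > 0"
  shows "\<exists>n. \<exists>s\<in>{0..1}. \<exists>i j::int. L ^ n * \<alpha> s + real n * (L ^ n / L) * m * \<beta> s = a + of_int i \<and>
           \<bar>L ^ n * \<beta> s - b - of_int j\<bar> < e"
proof -
  define \<delta> where "\<delta> = \<bar>\<beta>' t0\<bar> / 2"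
  have \<delta>: "\<delta> > 0" using t0 by (simp add: \<delta>_def)
  obtain r1 where r1: "r1 > 0" "\<And>s. s \<in> {0..1} \<Longrightarrow> \<bar>s - t0\<bar> < r1 \<Longrightarrow> \<bar>\<beta>' s - \<beta>' t0\<bar> < \<delta>"
    using cont(2) t0(1) \<delta> unfolding continuous_on_iff dist_real_def by meson
  obtain r2 where r2: "r2 > 0" "\<And>s. s \<in> {0..1} \<Longrightarrow> \<bar>s - t0\<bar> < r2 \<Longrightarrow> \<bar>\<alpha>' s - \<alpha>' t0\<bar> < 1"
    using cont(1) t0(1) zero_less_one unfolding continuous_on_iff dist_real_def by meson
  \<comment> \<open>All motion takes place in an interval \<open>{p..p + w}\<close> in which both derivatives are almost constant: its
    first half is used to adjust the second coordinate, and adjusting the first one afterwards takes at most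
    time \<open>w / 2\<close>.\<close>
  define w where "w = min (min r1 r2) 1 / 4"
  have w: "0 < w" "w < r1" "w < r2" "w \<le> 1/4" using r1(1) r2(1) by (auto simp: w_def)
  define p where "p = (if t0 \<le> 1/2 then t0 else t0 - w)"
  have I: "{p..p + w} \<subseteq> {0..1}" using t0(1) w by (auto simp: p_def split: if_splits)
  have near: "\<bar>s - t0\<bar> < r1 \<and> \<bar>s - t0\<bar> < r2" if "s \<in> {p..p + w}" for s
    using that w by (auto simp: p_def split: if_splits)
  define Ad where "Ad = \<bar>\<alpha>' t0\<bar> + 1"
  have b\<alpha>: "\<bar>\<alpha>' s\<bar> \<le> Ad" if "s \<in> {p..p + w}" for s
    using r2(2)[of s] near[OF that] that I unfolding Ad_def by fastforce
  have b\<beta>: "\<delta> \<le> \<bar>\<beta>' s\<bar>" "\<bar>\<beta>' s\<bar> \<le> 3 * \<delta>" if "s \<in> {p..p + w}" for s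
  proof -
    have "\<bar>\<beta>' s - \<beta>' t0\<bar> < \<delta>" using r1(2)[of s] near[OF that] that I by blast
    then show "\<delta> \<le> \<bar>\<beta>' s\<bar>" "\<bar>\<beta>' s\<bar> \<le> 3 * \<delta>" unfolding \<delta>_def by linarith+
  qed
  \<comment> \<open>For large \<open>n\<close>, the first coordinate of the image has speed at least \<open>\<bar>L\<bar>\<^sup>n n \<mu>\<close>: half of the
    contribution of the shear, the other half compensating the term with \<open>\<alpha>\<close>.\<close>
  define \<mu> where "\<mu> = \<bar>m\<bar> * \<delta> / (2 * \<bar>L\<bar>)"
  have \<mu>: "\<mu> > 0" using \<delta> L \<open>m \<noteq> 0\<close> by (simp add: \<mu>_def)
  have "\<forall>\<^sub>F n in sequentially. real n > Ad / \<mu> + 2 / (\<mu> * w) + 3 * \<delta> / (\<mu> * e)"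
    using filterlim_real_sequentially unfolding filterlim_at_top_dense by blast
  moreover have "\<forall>\<^sub>F n in sequentially. \<bar>L\<bar> ^ n > 2 / (\<delta> * w)"
    using filterlim_power_at_top[of "\<bar>L\<bar>" "\<lambda>n. n"] L unfolding filterlim_at_top_dense by simp
  ultimately have "\<forall>\<^sub>F n in sequentially. real n > Ad / \<mu> + 2 / (\<mu> * w) + 3 * \<delta> / (\<mu> * e) \<and> \<bar>L\<bar> ^ n > 2 / (\<delta> * w)"
    by (rule eventually_conj)
  then obtain n where n: "real n > Ad / \<mu> + 2 / (\<mu> * w) + 3 * \<delta> / (\<mu> * e)" "\<bar>L\<bar> ^ n > 2 / (\<delta> * w)"
    by (auto simp: eventually_sequentially)
  have nn: "Ad / \<mu> > 0" "2 / (\<mu> * w) > 0" "3 * \<delta> / (\<mu> * e) > 0"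
    using \<mu> w \<delta> \<open>e > 0\<close> by (auto simp: Ad_def intro!: divide_pos_pos)
  have n1: "Ad \<le> real n * \<mu>" and n2: "2 < real n * \<mu> * w" and n3: "3 * \<delta> < real n * \<mu> * e"
  proof -
    have "Ad / \<mu> < n" "2 / (\<mu> * w) < n" "3 * \<delta> / (\<mu> * e) < n" using n(1) nn by linarith+
    then show "Ad \<le> real n * \<mu>" "2 < real n * \<mu> * w" "3 * \<delta> < real n * \<mu> * e"
      using \<mu> w \<open>e > 0\<close> by (simp_all add: field_simps)
  qed
  have npos: "real n > 0" using n1 \<mu> by (smt (verit) Ad_def mult_nonpos_nonneg)
  define \<Lambda> where "\<Lambda> = \<bar>L\<bar> ^ n"
  have \<Lambda>: "\<Lambda> \<ge> 1" using L by (simp add: \<Lambda>_def)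
  have derivI: "(f has_real_derivative f') (at s within {x..y})"
    if "(f has_real_derivative f') (at s within {0..1})" "{x..y} \<subseteq> {0..1}" for f f' s x and y :: real
    using that by (rule DERIV_subset)
  have \<beta>n: "((\<lambda>s. L ^ n * \<beta> s) has_real_derivative L ^ n * \<beta>' s) (at s within {0..1})" if "s \<in> {0..1}" for s
    by (rule DERIV_cmult[OF \<beta>[OF that]])
  define u where "u s = L ^ n * \<alpha> s + real n * (L ^ n / L) * m * \<beta> s" for s
  define u' where "u' s = L ^ n * \<alpha>' s + real n * (L ^ n / L) * m * \<beta>' s" for s
  have un: "(u has_real_derivative u' s) (at s within {0..1})" if "s \<in> {0..1}" for s
    unfolding u_def u'_def by (intro DERIV_add DERIV_cmult \<alpha> \<beta> that)
  have u'_ge: "\<bar>u' s\<bar> \<ge> \<Lambda> * (real n * \<mu>)" if "s \<in> {p..p + w}" for s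
  proof -
    have "\<bar>u' s\<bar> \<ge> \<bar>real n * (L ^ n / L) * m * \<beta>' s\<bar> - \<bar>L ^ n * \<alpha>' s\<bar>"
      using abs_triangle_ineq2[of "real n * (L ^ n / L) * m * \<beta>' s" "- (L ^ n * \<alpha>' s)"]
      unfolding u'_def by (simp add: add.commute)
    moreover have "\<bar>L ^ n * \<alpha>' s\<bar> \<le> \<Lambda> * Ad"
      using b\<alpha>[OF that] \<Lambda> by (simp add: abs_mult power_abs \<Lambda>_def mult_left_mono)
    moreover have "\<bar>real n * (L ^ n / L) * m * \<beta>' s\<bar> = (\<Lambda> * real n * (\<bar>m\<bar> / \<bar>L\<bar>)) * \<bar>\<beta>' s\<bar>"
      by (simp add: abs_mult power_abs \<Lambda>_def)
    moreover have "(\<Lambda> * real n * (\<bar>m\<bar> / \<bar>L\<bar>)) * \<bar>\<beta>' s\<bar> \<ge> (\<Lambda> * real n * (\<bar>m\<bar> / \<bar>L\<bar>)) * \<delta>"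
      using b\<beta>(1)[OF that] \<Lambda> by (intro mult_left_mono) auto
    moreover have "(\<Lambda> * real n * (\<bar>m\<bar> / \<bar>L\<bar>)) * \<delta> = 2 * (\<Lambda> * (real n * \<mu>))"
      by (simp add: \<mu>_def)
    moreover have "\<Lambda> * Ad \<le> \<Lambda> * (real n * \<mu>)" using n1 \<Lambda> by (intro mult_left_mono) auto
    ultimately show ?thesis by linarith
  qed
  have "\<exists>s\<in>{p..p + w / 2}. \<exists>j::int. L ^ n * \<beta> s = b + of_int j"
  proof (rule continuous_hits_integer_translate)
    show "p \<le> p + w / 2" using w by simp
    have sub: "{p..p + w / 2} \<subseteq> {0..1}" using I w by auto
    have D: "((\<lambda>s. L ^ n * \<beta> s) has_real_derivative L ^ n * \<beta>' s) (at s within {p..p + w / 2})"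
      if "s \<in> {p..p + w / 2}" for s
      using derivI[OF \<beta>n sub] that sub by blast
    then show "continuous_on {p..p + w / 2} (\<lambda>s. L ^ n * \<beta> s)"
      by (rule DERIV_continuous_on)
    show "1 \<le> \<bar>L ^ n * \<beta> (p + w / 2) - L ^ n * \<beta> p\<bar>"
    proof (rule derivative_lower_bound_increment[where u = "\<lambda>s. L ^ n * \<beta> s" and x = p and y = "p + w / 2" and u' = "\<lambda>s. L ^ n * \<beta>' s" and k = "\<Lambda> * \<delta>"])
      show "p < p + w / 2" using w by simp
      show "1 \<le> \<Lambda> * \<delta> * (p + w / 2 - p)"
        using n(2) \<delta> w by (simp add: \<Lambda>_def field_simps)
      show "\<Lambda> * \<delta> \<le> \<bar>L ^ n * \<beta>' s\<bar>" if "s \<in> {p..p + w / 2}" for s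
        using b\<beta>(1)[of s] that w \<Lambda> by (simp add: abs_mult power_abs \<Lambda>_def mult_left_mono)
    qed (rule D)
  qed
  then obtain s0 j where s0: "s0 \<in> {p..p + w / 2}" "L ^ n * \<beta> s0 = b + of_int j" by blast
  define \<tau> where "\<tau> = 1 / (\<Lambda> * (real n * \<mu>))"
  have pos: "\<Lambda> * (real n * \<mu>) > 0" using \<Lambda> npos \<mu> by simp
  have \<tau>: "\<tau> > 0" "\<tau> \<le> w / 2"
  proof -
    show "\<tau> > 0" using pos by (simp add: \<tau>_def)
    have "2 \<le> \<Lambda> * (real n * \<mu> * w)"
      using mult_mono[of 1 \<Lambda> 2 "real n * \<mu> * w"] n2 \<Lambda> by simp
    then show "\<tau> \<le> w / 2" using pos by (simp add: \<tau>_def field_simps)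
  qed
  have sub: "{s0..s0 + \<tau>} \<subseteq> {p..p + w}" using s0(1) \<tau> by auto
  have "\<exists>s\<in>{s0..s0 + \<tau>}. \<exists>i::int. u s = a + of_int i"
  proof (rule continuous_hits_integer_translate)
    show "s0 \<le> s0 + \<tau>" using \<tau> by simp
    have D: "(u has_real_derivative u' s) (at s within {s0..s0 + \<tau>})" if "s \<in> {s0..s0 + \<tau>}" for s
      using derivI[OF un] that sub I by blast
    then show "continuous_on {s0..s0 + \<tau>} u"
      by (rule DERIV_continuous_on)
    show "1 \<le> \<bar>u (s0 + \<tau>) - u s0\<bar>"
    proof (rule derivative_lower_bound_increment[where u = u and x = s0 and y = "s0 + \<tau>" and u' = u' and k = "\<Lambda> * (real n * \<mu>)"])
      show "s0 < s0 + \<tau>" using \<tau> by simp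
      show "1 \<le> \<Lambda> * (real n * \<mu>) * (s0 + \<tau> - s0)" using \<Lambda> npos \<mu> by (simp add: \<tau>_def)
      show "\<Lambda> * (real n * \<mu>) \<le> \<bar>u' s\<bar>" if "s \<in> {s0..s0 + \<tau>}" for s
        using u'_ge that sub by blast
    qed (rule D)
  qed
  then obtain s i where s: "s \<in> {s0..s0 + \<tau>}" "u s = a + of_int i" by blast
  have "\<bar>L ^ n * \<beta> s - L ^ n * \<beta> s0\<bar> \<le> \<Lambda> * (3 * \<delta>) * \<bar>s - s0\<bar>"
  proof -
    have "norm (L ^ n * \<beta> s - L ^ n * \<beta> s0) \<le> \<Lambda> * (3 * \<delta>) * norm (s - s0)"
    proof (rule field_differentiable_bound[where S = "{s0..s0 + \<tau>}" and f = "\<lambda>s. L ^ n * \<beta> s" and f' = "\<lambda>s. L ^ n * \<beta>' s"])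
      show "((\<lambda>s. L ^ n * \<beta> s) has_real_derivative L ^ n * \<beta>' z) (at z within {s0..s0 + \<tau>})"
        if "z \<in> {s0..s0 + \<tau>}" for z
        using derivI[OF \<beta>n] that sub I by blast
      show "norm (L ^ n * \<beta>' z) \<le> \<Lambda> * (3 * \<delta>)" if "z \<in> {s0..s0 + \<tau>}" for z
        using b\<beta>(2)[of z] that sub \<Lambda> by (auto simp: abs_mult power_abs \<Lambda>_def intro!: mult_left_mono)
    qed (use s \<tau> in auto)
    then show ?thesis by simp
  qed
  also have "\<dots> \<le> \<Lambda> * (3 * \<delta>) * \<tau>"
    using s(1) \<Lambda> \<delta> by (intro mult_left_mono) auto
  also have "\<dots> = 3 * \<delta> / (real n * \<mu>)" using \<Lambda> by (simp add: \<tau>_def)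
  also have "\<dots> < e" using n3 npos \<mu> by (simp add: field_simps)
  finally have "\<bar>L ^ n * \<beta> s - b - of_int j\<bar> < e" using s0(2) by simp
  moreover have "s \<in> {0..1}" using s(1) sub I by blast
  ultimately show ?thesis using s(2) unfolding u_def by blast
qed

lemma shear_form_funpow:
  assumes "L \<noteq> 0" and A: "\<And>x. linear_lift A x = L *\<^sub>R x + (\<kappa> * (e $ 1 * x $ 2 - e $ 2 * x $ 1)) *\<^sub>R (e :: real ^ 2)"
  shows "(linear_lift A ^^ n) x = L ^ n *\<^sub>R x + (real n * (L ^ n / L) * \<kappa> * (e $ 1 * x $ 2 - e $ 2 * x $ 1)) *\<^sub>R e"
proof (induction n)
  case (Suc n)
  define y where "y = (linear_lift A ^^ n) x"
  define w where "w = e $ 1 * x $ 2 - e $ 2 * x $ 1"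
  have y: "y = L ^ n *\<^sub>R x + (real n * (L ^ n / L) * \<kappa> * w) *\<^sub>R e"
    using Suc unfolding y_def w_def .
  have "e $ 1 * y $ 2 - e $ 2 * y $ 1 = L ^ n * w"
    unfolding y by (simp add: w_def algebra_simps)
  then have "(linear_lift A ^^ Suc n) x = L *\<^sub>R y + (\<kappa> * (L ^ n * w)) *\<^sub>R e"
    using A[of y] by (simp add: y_def)
  also have "\<dots> = L ^ Suc n *\<^sub>R x + (L * (real n * (L ^ n / L) * \<kappa> * w) + \<kappa> * (L ^ n * w)) *\<^sub>R e"
    unfolding y by (simp add: algebra_simps)
  also have "L * (real n * (L ^ n / L) * \<kappa> * w) + \<kappa> * (L ^ n * w) = real (Suc n) * (L ^ Suc n / L) * \<kappa> * w"
    using assms(1) by (simp add: field_simps)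
  finally show ?case unfolding w_def .
qed simp

text \<open>
  The function \<open>W\<close> measures the position across the eigendirection; it takes integer values on integer vectors,
  so it descends to the torus modulo one. If \<open>W\<close> varies on an arc of the boundary, the images of the
  arc are dense. Hence \<open>W\<close> is constant on each of the finitely many arcs, and the boundary only meets lines
  \<open>x + \<real> e\<close> for countably many values of \<open>W\<close>. For a line that avoids these values, together with its
  image, the whole line stays in the interior of one cell \<open>R\<close>. It contains \<open>x\<close> and
  \<open>x + e / L\<^sup>k\<^sup>+\<^sup>1\<close>, where \<open>e / L\<^sup>k\<close> is integral and \<open>e / L\<^sup>k\<^sup>+\<^sup>1\<close> is not: two different points of the torus
  with the same image.
\<close>
lemma nondiagonalizable_not_smooth:
  fixes A :: "int ^ 2 ^ 2"
  assumes "expanding A" and M: "markov_partition (toral_endomorphism A) M"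
    and nd: "\<not> complex_diagonalizable A"
  shows "\<not> smooth_partition M"
proof
  assume "smooth_partition M"
  then obtain \<C> where "finite \<C> \<and> (\<forall>C\<in>\<C>. C1_arc C) \<and> partition_boundary M = \<Union>\<C>"
    unfolding smooth_partition_def by (rule exE)
  then have \<C>: "finite \<C>" "\<And>C. C \<in> \<C> \<Longrightarrow> C1_arc C" "partition_boundary M = \<Union>\<C>"
    by simp_all
  define B where "B = partition_boundary M"
  have B: "closed B" "toral_endomorphism A ` B \<subseteq> B" "B \<noteq> UNIV"
    unfolding B_def using closed_partition_boundary[OF M] partition_boundary_forward_invariant[OF assms(1) M]
      partition_boundary_neq_UNIV[OF M] by auto
  obtain L0 :: int and e :: "real ^ 2" and \<kappa> where shear: "\<bar>L0\<bar> \<ge> 2 \<and> (\<forall>i. e $ i \<in> \<int>) \<and> e \<noteq> 0 \<and> \<kappa> \<noteq> 0 \<and>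
      (\<forall>x. linear_lift A x = of_int L0 *\<^sub>R x + (\<kappa> * (e $ 1 * x $ 2 - e $ 2 * x $ 1)) *\<^sub>R e)"
    using nondiagonalizable_shear_form[OF assms(1) nd] by (elim exE)
  then have L0: "\<bar>L0\<bar> \<ge> 2" and e: "\<And>i. e $ i \<in> \<int>" "e \<noteq> 0" and "\<kappa> \<noteq> 0"
    and A: "\<And>x. linear_lift A x = of_int L0 *\<^sub>R x + (\<kappa> * (e $ 1 * x $ 2 - e $ 2 * x $ 1)) *\<^sub>R e"
    by (elim conjE; simp)+
  define L where "L = real_of_int L0"
  have L: "\<bar>L\<bar> \<ge> 2" using L0 by (simp add: L_def)
  have "L \<noteq> 0" using L by auto
  define W where "W x = e $ 1 * x $ 2 - e $ 2 * x $ 1" for x :: "real ^ 2"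
  have AW: "linear_lift A x = L *\<^sub>R x + (\<kappa> * W x) *\<^sub>R e" for x
    unfolding A W_def L_def ..
  have WA: "W (linear_lift A x) = L * W x" for x
    unfolding AW by (simp add: W_def algebra_simps)
  have linW: "linear W" by (rule linearI) (simp_all add: W_def algebra_simps)
  have WInt: "W x - W y \<in> \<int>" if "torus_proj x = torus_proj y" for x y
  proof -
    have "W x - W y = e $ 1 * (x $ 2 - y $ 2) - e $ 2 * (x $ 1 - y $ 1)"
      by (simp add: W_def algebra_simps)
    then show ?thesis using that e(1) by (simp add: torus_proj_eq_iff)
  qed
  \<comment> \<open>The vectors \<open>e\<close> and \<open>e'\<close> span a sublattice of the integer vectors, and density modulo this sublattice
    implies density modulo the integer vectors.\<close>
  define e' :: "real ^ 2" where "e' = vector [- e $ 2, e $ 1]"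
  have e': "e' $ i \<in> \<int>" for i using e(1) exhaust_2[of i] by (auto simp: e'_def)
  define q where "q = (e $ 1)\<^sup>2 + (e $ 2)\<^sup>2"
  have q: "q > 0" using e(2) by (auto simp: q_def vec_eq_iff forall_2 sum_power2_gt_zero_iff)
  define U where "U x = (e $ 1 * x $ 1 + e $ 2 * x $ 2) / q" for x :: "real ^ 2"
  have linU: "linear U" by (rule linearI) (simp_all add: U_def algebra_simps add_divide_distrib)
  have dec: "x = U x *\<^sub>R e + (W x / q) *\<^sub>R e'" for x
  proof -
    have "(e $ 1 * x $ 1 + e $ 2 * x $ 2) * e $ 1 - W x * e $ 2 = q * x $ 1"
      "(e $ 1 * x $ 1 + e $ 2 * x $ 2) * e $ 2 + W x * e $ 1 = q * x $ 2"
      by (simp_all add: W_def q_def algebra_simps power2_eq_square)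
    then show ?thesis
      using q by (simp add: vec_eq_iff forall_2 U_def e'_def field_simps)
  qed
  have "\<exists>r. \<forall>p\<in>C. \<exists>x. torus_proj x = p \<and> W x = r" if C: "C \<in> \<C>" for C
  proof -
    obtain g g' where g: "C = (\<lambda>s. torus_proj (g s)) ` {0..1}" "continuous_on {0..1} g'"
      "\<And>t. t \<in> {0..1} \<Longrightarrow> (g has_vector_derivative g' t) (at t within {0..1})"
      "\<And>t. t \<in> {0..1} \<Longrightarrow> g' t \<noteq> 0"
      using C1_arc_lift[OF \<C>(2)[OF C]] by metis
    have gB: "torus_proj (g s) \<in> B" if "s \<in> {0..1}" for s
      using that g(1) C \<C>(3) unfolding B_def by blast
    have blW: "bounded_linear W" and blU: "bounded_linear U"
      using linW linU linear_conv_bounded_linear by blast+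
    have dW: "((\<lambda>s. W (g s)) has_real_derivative W (g' t)) (at t within {0..1})" if "t \<in> {0..1}" for t
      using bounded_linear.has_vector_derivative[OF blW g(3)[OF that]]
      by (simp add: has_real_derivative_iff_has_vector_derivative)
    have dU: "((\<lambda>s. U (g s)) has_real_derivative U (g' t)) (at t within {0..1})" if "t \<in> {0..1}" for t
      using bounded_linear.has_vector_derivative[OF blU g(3)[OF that]]
      by (simp add: has_real_derivative_iff_has_vector_derivative)
    have "W (g' t) = 0" if t: "t \<in> {0..1}" for t
    proof (rule ccontr)
      assume nz: "W (g' t) \<noteq> 0"
      have "torus_proj z \<in> closure B" for z :: "real ^ 2"
      proof -
        have "\<exists>p\<in>B. dist p (torus_proj z) < \<epsilon>" if \<epsilon>: "\<epsilon> > 0" for \<epsilon>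
        proof -
          define \<epsilon>' where "\<epsilon>' = \<epsilon> / (norm e' + 1)"
          have ne': "norm e' + 1 > 0" using norm_ge_zero[of e'] by linarith
          then have \<epsilon>': "\<epsilon>' > 0" using \<epsilon> by (simp add: \<epsilon>'_def)
          have "\<exists>n. \<exists>s\<in>{0..1}. \<exists>i j::int.
              L ^ n * U (g s) + real n * (L ^ n / L) * (\<kappa> * q) * (W (g s) / q) = U z + of_int i \<and>
              \<bar>L ^ n * (W (g s) / q) - W z / q - of_int j\<bar> < \<epsilon>'"
          proof (rule sheared_curve_dense[OF dU _ _ _ t])
            show "((\<lambda>s. W (g s) / q) has_real_derivative W (g' t) / q) (at t within {0..1})"
              if "t \<in> {0..1}" for t
              using dW[OF that] by (rule DERIV_cdivide)
            show "continuous_on {0..1} (\<lambda>t. U (g' t))" "continuous_on {0..1} (\<lambda>t. W (g' t) / q)"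
              using q by (intro continuous_intros bounded_linear.continuous_on[OF blU] bounded_linear.continuous_on[OF blW] g(2); simp)+
            show "W (g' t) / q \<noteq> 0" "\<kappa> * q \<noteq> 0" using nz q \<open>\<kappa> \<noteq> 0\<close> by auto
          qed (use L \<epsilon>' in auto)
          then obtain n s i j where s: "s \<in> {0..1}"
            and U: "L ^ n * U (g s) + real n * (L ^ n / L) * (\<kappa> * q) * (W (g s) / q) = U z + of_int i"
            and V: "\<bar>L ^ n * (W (g s) / q) - W z / q - of_int j\<bar> < \<epsilon>'"
            by blast
          define y where "y = (linear_lift A ^^ n) (g s)"
          have "y = L ^ n *\<^sub>R g s + (real n * (L ^ n / L) * \<kappa> * W (g s)) *\<^sub>R e"
            unfolding y_def W_def
            by (rule shear_form_funpow[OF \<open>L \<noteq> 0\<close>]) (simp add: AW W_def)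
          also have "\<dots> = (L ^ n * U (g s) + real n * (L ^ n / L) * (\<kappa> * q) * (W (g s) / q)) *\<^sub>R e + (L ^ n * (W (g s) / q)) *\<^sub>R e'"
            using q by (subst dec[of "g s"]) (simp add: algebra_simps)
          also have "\<dots> = (U z + of_int i) *\<^sub>R e + (L ^ n * (W (g s) / q)) *\<^sub>R e'"
            unfolding U ..
          finally have y: "y = (U z + of_int i) *\<^sub>R e + (L ^ n * (W (g s) / q)) *\<^sub>R e'" .
          define z' where "z' = z + (of_int i *\<^sub>R e + of_int j *\<^sub>R e')"
          have z': "torus_proj z' = torus_proj z"
            unfolding z'_def by (rule torus_proj_add_integer) (simp add: e(1) e')
          have "y - z' = (L ^ n * (W (g s) / q) - W z / q - of_int j) *\<^sub>R e'"
            unfolding y z'_def by (subst (2) dec[of z]) (simp add: algebra_simps)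
          then have "norm (y - z') \<le> \<epsilon>' * norm e'"
            using V by (simp add: mult_right_mono)
          also have "\<dots> < \<epsilon>" using ne' \<epsilon> by (simp add: \<epsilon>'_def field_simps)
          finally have "dist (torus_proj y) (torus_proj z) < \<epsilon>"
            using dist_torus_le[of y z'] unfolding z' by (simp add: dist_norm)
          moreover have "torus_proj y \<in> B"
            unfolding y_def toral_endomorphism_funpow_proj[symmetric]
            using forward_invariant_funpow[OF B(2) gB[OF s]] .
          ultimately show ?thesis by blast
        qed
        then show ?thesis by (simp add: closure_approachable)
      qed
      then have "p \<in> B" for p using B(1) torus_proj_surj[of p] by (auto simp: closure_closed)
      then show False using B(3) by blast
    qed
    then have "((\<lambda>s. W (g s)) has_vector_derivative 0) (at t within {0..1})" if "t \<in> {0..1}" for t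
      using dW[OF that] that by (simp add: has_real_derivative_iff_has_vector_derivative)
    then obtain r where "\<And>s. s \<in> {0..1} \<Longrightarrow> W (g s) = r"
      using has_vector_derivative_zero_constant[of "{0..1}" "\<lambda>s. W (g s)"] by (metis convex_real_interval(5))
    then show ?thesis unfolding g(1) by blast
  qed
  then obtain r where r: "\<And>C p. C \<in> \<C> \<Longrightarrow> p \<in> C \<Longrightarrow> \<exists>x. torus_proj x = p \<and> W x = r C" by metis
  define Bad where "Bad = (\<Union>C\<in>\<C>. range (\<lambda>k::int. r C + of_int k))"
  have Bad: "W x \<in> Bad" if x: "torus_proj x \<in> B" for x
  proof -
    obtain C where C: "C \<in> \<C>" "torus_proj x \<in> C" using x \<C>(3) unfolding B_def by blast
    obtain y where y: "torus_proj y = torus_proj x" "W y = r C" using r[OF C] by blast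
    have "W x - W y \<in> \<int>" using y(1) by (intro WInt) simp
    then obtain k where "W x - W y = of_int k" by (rule Ints_cases)
    then have "W x = r C + of_int k" using y(2) by simp
    then show ?thesis using C(1) unfolding Bad_def by blast
  qed
  have "countable Bad" unfolding Bad_def using \<C>(1) by (simp add: countable_finite)
  obtain R p0 where R: "R \<in> M" "p0 \<in> interior R"
    using markov_partition_cover[OF M] markov_partition_interior_nonempty[OF M] by (metis ex_in_conv)
  obtain x0 where x0: "torus_proj x0 = p0" using torus_proj_surj by blast
  have "open (torus_proj -` interior R)" by (rule open_vimage_torus_proj) simp
  moreover have "x0 \<in> torus_proj -` interior R" using R(2) x0 by simp
  ultimately obtain \<eta> where \<eta>: "\<eta> > 0" "ball x0 \<eta> \<subseteq> torus_proj -` interior R"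
    by (meson openE)
  define \<eta>' where "\<eta>' = \<eta> / (norm e' + 1)"
  have ne': "norm e' + 1 > 0" using norm_ge_zero[of e'] by linarith
  have "\<eta>' > 0" using \<eta>(1) ne' by (simp add: \<eta>'_def)
  \<comment> \<open>The shifts of \<open>x0\<close> that lead to a bad value of \<open>W\<close> at the point itself or at its image.\<close>
  define S where "S = (\<lambda>w. (w - W x0) / q) ` Bad \<union> (\<lambda>w. (w / L - W x0) / q) ` Bad"
  have "countable S" unfolding S_def using \<open>countable Bad\<close> by simp
  then have "\<not> {0<..<\<eta>'} \<subseteq> S"
    using \<open>\<eta>' > 0\<close> countable_subset uncountable_open_interval by blast
  then obtain s where "s \<in> {0<..<\<eta>'}" and sS: "s \<notin> S" by blast
  then have s: "0 < s" "s < \<eta>'" by simp_all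
  define x where "x = x0 + s *\<^sub>R e'"
  have We': "W e' = q" by (simp add: W_def e'_def q_def power2_eq_square)
  have Wx: "W x = W x0 + s * q"
    unfolding x_def by (simp add: linear_add[OF linW] linear_scale[OF linW] We')
  have "W x \<notin> Bad"
  proof
    assume "W x \<in> Bad"
    moreover have "s = (W x - W x0) / q" using q by (simp add: Wx)
    ultimately show False using sS unfolding S_def by blast
  qed
  have "L * W x \<notin> Bad"
  proof
    assume "L * W x \<in> Bad"
    moreover have "s = (L * W x / L - W x0) / q" using q \<open>L \<noteq> 0\<close> by (simp add: Wx)
    ultimately show False using sS unfolding S_def by blast
  qed
  have "x \<in> ball x0 \<eta>"
  proof -
    have "norm (s *\<^sub>R e') \<le> s * (norm e' + 1)" using s by simp
    also have "\<dots> < \<eta>' * (norm e' + 1)" using s(2) ne' by (rule mult_strict_right_mono)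
    also have "\<dots> = \<eta>" using ne' by (simp add: \<eta>'_def)
    finally show ?thesis by (simp add: x_def dist_norm)
  qed
  then have xR: "torus_proj x \<in> interior R" using \<eta>(2) by blast
  have Compl: "- B = (\<Union>R\<in>M. interior R)" unfolding B_def by (rule Compl_partition_boundary[OF M])
  have We: "W (x + t *\<^sub>R e) = W x" for t by (simp add: W_def algebra_simps)
  have line: "torus_proj (x + t *\<^sub>R e) \<in> interior R" for t
  proof (rule ccontr)
    assume out: "torus_proj (x + t *\<^sub>R e) \<notin> interior R"
    define T where "T = range (\<lambda>t. torus_proj (x + t *\<^sub>R e))"
    have "connected T"
      unfolding T_def by (intro connected_continuous_image) (auto intro!: continuous_on_compose2[OF continuous_on_torus_proj] continuous_intros)
    moreover have TB: "T \<subseteq> (\<Union>R\<in>M. interior R)"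
      unfolding Compl[symmetric] T_def
    proof (intro subsetI ComplI, elim rangeE)
      fix p t assume "p \<in> B" "p = torus_proj (x + t *\<^sub>R e)"
      then show False using Bad[of "x + t *\<^sub>R e"] \<open>W x \<notin> Bad\<close> We by simp
    qed
    moreover define O' where "O' = (\<Union>R'\<in>M - {R}. interior R')"
    have "open O'" unfolding O'_def by auto
    moreover have "T \<subseteq> interior R \<union> O'" using TB unfolding O'_def by blast
    moreover have "interior R \<inter> O' = {}"
      unfolding O'_def using markov_partition_disjoint[OF M R(1)] by blast
    moreover have "torus_proj (x + 0 *\<^sub>R e) \<in> interior R" using xR by simp
    moreover have "torus_proj (x + 0 *\<^sub>R e) \<in> T" "torus_proj (x + t *\<^sub>R e) \<in> T"
      unfolding T_def by (rule rangeI)+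
    ultimately show False
      using out connectedD[of T "interior R" O'] open_interior[of R] by blast
  qed
  obtain R' where R': "R' \<in> M" "torus_proj (linear_lift A x) \<in> interior R'"
  proof -
    have "torus_proj (linear_lift A x) \<notin> B"
      using Bad[of "linear_lift A x"] \<open>L * W x \<notin> Bad\<close> unfolding WA by blast
    then show ?thesis using that Compl by blast
  qed
  \<comment> \<open>The vector \<open>e\<close> may be divisible by a power of \<open>L\<close>; divide it by the last such power.\<close>
  define Z where "Z k \<longleftrightarrow> (\<forall>i. e $ i / L ^ k \<in> \<int>)" for k :: nat
  have "\<exists>k. \<not> Z k"
  proof -
    obtain i where i: "e $ i \<noteq> 0" using e(2) by (auto simp: vec_eq_iff)
    have "\<bar>L\<bar> > 1" using L by linarith
    then obtain k where k: "\<bar>e $ i\<bar> < \<bar>L\<bar> ^ k" using real_arch_pow by blast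
    have "\<bar>e $ i / L ^ k\<bar> < 1" using k \<open>L \<noteq> 0\<close> by (simp add: power_abs[symmetric] field_simps)
    moreover have "e $ i / L ^ k \<noteq> 0" using i \<open>L \<noteq> 0\<close> by simp
    ultimately have "e $ i / L ^ k \<notin> \<int>" using Ints_nonzero_abs_less1 by blast
    then show ?thesis unfolding Z_def by blast
  qed
  moreover have "Z 0" using e(1) by (simp add: Z_def)
  ultimately obtain k where k: "Z k" "\<not> Z (Suc k)" using nat_induct[of Z] by blast
  define x' where "x' = x + (1 / L ^ Suc k) *\<^sub>R e"
  have Ax': "torus_proj (linear_lift A x') = torus_proj (linear_lift A x)"
  proof -
    have "linear_lift A x' = linear_lift A x + (1 / L ^ k) *\<^sub>R e"
      unfolding AW x'_def We using \<open>L \<noteq> 0\<close> by (simp add: scaleR_add_right algebra_simps)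
    then show ?thesis using k(1) by (simp add: torus_proj_add_integer Z_def)
  qed
  have "\<exists>!y. y \<in> R \<and> toral_endomorphism A y = torus_proj (linear_lift A x)"
  proof (rule markov_partition_unique_preimage[OF M R(1) R'(1) _ R'(2)])
    show "toral_endomorphism A ` interior R \<inter> interior R' \<noteq> {}"
      using xR R'(2) toral_endomorphism_proj[of A x] by (metis IntI empty_iff imageI)
  qed
  moreover have "torus_proj x \<in> R" "torus_proj x' \<in> R"
    using xR line[of "1 / L ^ Suc k"] interior_subset unfolding x'_def by blast+
  ultimately have "torus_proj x' = torus_proj x"
    using Ax' by (metis toral_endomorphism_proj)
  then have "(x' - x) $ i \<in> \<int>" for i by (simp add: torus_proj_eq_iff)
  then have "Z (Suc k)" unfolding Z_def x'_def by simp
  then show False using k(2) by blast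
qed

section \<open>A hybrid Markov partition\<close>

definition shear_matrix :: "int ^ 2 ^ 2" where
  "shear_matrix = vector [vector [8, 1], vector [0, 8]]"

lemma shear_matrix_lift:
  "linear_lift shear_matrix x $ 1 = 8 * x $ 1 + x $ 2" "linear_lift shear_matrix x $ 2 = 8 * x $ 2"
  by (simp_all add: linear_lift_2 shear_matrix_def)

lemma expanding_shear_matrix: "expanding shear_matrix"
  unfolding expanding_def
proof (intro allI impI)
  fix l assume "complex_eigenvalue shear_matrix l"
  then have "l = 8" unfolding complex_eigenvalue_2 by (simp add: shear_matrix_def)
  then show "1 < cmod l" by simp
qed

lemma not_complex_diagonalizable_shear_matrix: "\<not> complex_diagonalizable shear_matrix"
proof
  let ?A = "map_matrix complex_of_int shear_matrix"
  assume "complex_diagonalizable shear_matrix"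
  then obtain P D :: "complex ^ 2 ^ 2" where PD: "invertible P \<and> (\<forall>i j. i \<noteq> j \<longrightarrow> D $ i $ j = 0) \<and>
      ?A = P ** D ** matrix_inv P"
    unfolding complex_diagonalizable_def by (elim exE)
  have inv: "matrix_inv P ** P = mat 1"
    using PD unfolding invertible_def matrix_inv_def by (metis (mono_tags, lifting) someI_ex)
  have "?A ** P = P ** D ** (matrix_inv P ** P)"
    using PD by (simp add: matrix_mul_assoc)
  then have AP: "?A ** P = P ** D" by (simp add: inv)
  have D: "D $ 1 $ 2 = 0" "D $ 2 $ 1 = 0" using PD by auto
  have E: "(?A ** P) $ i $ j = (P ** D) $ i $ j" for i j using AP by simp
  have "P $ 2 $ 1 = 0" using E[of 1 1] E[of 2 1] D by (auto simp: matrix_matrix_mult_def sum_2 shear_matrix_def)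
  moreover have "P $ 2 $ 2 = 0" using E[of 1 2] E[of 2 2] D by (auto simp: matrix_matrix_mult_def sum_2 shear_matrix_def)
  ultimately have "det P = 0" by (simp add: det_2)
  then show False using PD invertible_det_nz by blast
qed

text \<open>
  The solution of \<open>skew (8 y) = 8 skew y + frac y\<close> that is periodic and bounded. Subtracting it from the
  first coordinate removes the shear of the matrix, up to integers.
\<close>
definition skew :: "real \<Rightarrow> real" where
  "skew y = - (\<Sum>n. frac (8 ^ n * y) / 8 ^ Suc n)"

lemma skew_term_bounds:
  "0 \<le> frac (8 ^ n * y) / 8 ^ Suc n" "frac (8 ^ n * y) / 8 ^ Suc n \<le> (1/2) ^ Suc n" for y :: real
proof -
  show "0 \<le> frac (8 ^ n * y) / 8 ^ Suc n" by simp
  have "frac (8 ^ n * y) / 8 ^ Suc n \<le> 1 / 8 ^ Suc n"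
    by (intro divide_right_mono) (auto intro: less_imp_le[OF frac_lt_1])
  also have "\<dots> = (1/8) ^ Suc n" by (simp add: power_divide)
  also have "\<dots> \<le> (1/2) ^ Suc n" by (rule power_mono) auto
  finally show "frac (8 ^ n * y) / 8 ^ Suc n \<le> (1/2) ^ Suc n" .
qed

lemma skew_summable: "summable (\<lambda>n. frac (8 ^ n * y) / 8 ^ Suc n)" for y :: real
proof (rule summable_comparison_test')
  show "summable (\<lambda>n. (1/2::real) ^ Suc n)" using power_half_series by (rule sums_summable)
  show "norm (frac (8 ^ n * y) / 8 ^ Suc n) \<le> (1/2) ^ Suc n" if "n \<ge> 0" for n
    using skew_term_bounds[of n y] by simp
qed

lemma skew_bounds: "-1 \<le> skew y" "skew y \<le> 0"
proof -
  have "(\<Sum>n. frac (8 ^ n * y) / 8 ^ Suc n) \<le> (\<Sum>n. (1/2) ^ Suc n)"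
    by (rule suminf_le[OF skew_term_bounds(2) skew_summable sums_summable[OF power_half_series]])
  then show "-1 \<le> skew y" using sums_unique[OF power_half_series] by (simp add: skew_def)
  show "skew y \<le> 0" unfolding skew_def using suminf_nonneg[OF skew_summable skew_term_bounds(1)] by simp
qed

lemma skew_times_8: "skew (8 * y) = 8 * skew y + frac y"
proof -
  let ?f = "\<lambda>y n. frac (8 ^ n * y) / (8::real) ^ Suc n"
  have "suminf (?f y) = (\<Sum>n. ?f y (Suc n)) + ?f y 0"
    using suminf_split_head[OF skew_summable[of y]] by simp
  also have "(\<lambda>n. ?f y (Suc n)) = (\<lambda>n. ?f (8 * y) n / 8)" by (auto simp: mult_ac)
  also have "suminf (\<lambda>n. ?f (8 * y) n / 8) = suminf (?f (8 * y)) / 8"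
    by (rule suminf_divide[OF skew_summable])
  finally show ?thesis by (simp add: skew_def)
qed

lemma skew_add_of_int: "skew (y + of_int k) = skew y"
proof -
  have "frac (8 ^ n * (y + of_int k)) = frac (8 ^ n * y)" for n
  proof -
    have "8 ^ n * (y + of_int k) = 8 ^ n * y + of_int (8 ^ n * k)" by (simp add: algebra_simps)
    then show ?thesis by (simp only: frac_add_of_int_right)
  qed
  then show ?thesis by (simp add: skew_def)
qed

lemma skew_cong: "y - y' \<in> \<int> \<Longrightarrow> skew y = skew y'"
  by (metis Ints_cases add.commute diff_add_cancel skew_add_of_int)

text \<open>
  The first digit of the fractional part of \<open>u\<close> in base 8, written so that its continuity properties follow from
  those of the floor function.
\<close>
definition digit :: "real \<Rightarrow> int" where
  "digit u = \<lfloor>8 * u\<rfloor> - 8 * \<lfloor>u\<rfloor>"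

lemma digit_eq: "digit u = \<lfloor>8 * frac u\<rfloor>"
proof -
  have "8 * frac u = 8 * u - of_int (8 * \<lfloor>u\<rfloor>)" by (simp add: frac_def)
  then show ?thesis unfolding digit_def by (simp only: floor_diff_of_int)
qed

lemma digit_bounds: "0 \<le> digit u" "digit u \<le> 7"
  unfolding digit_eq using frac_ge_0[of u] frac_lt_1[of u] by linarith+

lemma frac_via_digit: "frac u = (of_int (digit u) + frac (8 * u)) / 8" for u :: real
  by (simp add: digit_def frac_def)

lemma digit_cong: "u - v \<in> \<int> \<Longrightarrow> digit u = digit v"
proof -
  assume "u - v \<in> \<int>"
  then obtain k where "u = v + of_int k" by (metis Ints_cases add.commute diff_add_cancel)
  then have "frac u = frac v" by simp
  then show ?thesis by (simp add: digit_eq)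
qed

text \<open>
  Both estimates pass from \<open>8 u\<close>, \<open>8 v\<close> to \<open>u\<close>, \<open>v\<close> through the functional equations of \<open>frac\<close> and
  \<open>skew\<close>. The second rate \<open>1/4\<close> is not optimal, but closed under the induction:
  \<open>((1/4)\<^sup>n + (1/4)\<^sup>n\<^sup>+\<^sup>1) / 8 \<le> (1/4)\<^sup>n\<^sup>+\<^sup>1\<close>.
\<close>
lemma equal_digits_close:
  assumes "\<And>k. k < n \<Longrightarrow> digit (8 ^ k * u) = digit (8 ^ k * v)"
  shows "\<bar>frac u - frac v\<bar> \<le> (1/8) ^ n" "\<bar>skew u - skew v\<bar> \<le> (1/4) ^ n"
proof -
  have "\<bar>frac u - frac v\<bar> \<le> (1/8) ^ n \<and> \<bar>skew u - skew v\<bar> \<le> (1/4) ^ n"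
    using assms
  proof (induction n arbitrary: u v)
    case 0
    have "\<bar>frac u - frac v\<bar> \<le> 1"
      using frac_ge_0[of u] frac_lt_1[of u] frac_ge_0[of v] frac_lt_1[of v] by linarith
    moreover have "\<bar>skew u - skew v\<bar> \<le> 1"
      using skew_bounds[of u] skew_bounds[of v] by linarith
    ultimately show ?case by simp
  next
    case (Suc n)
    have "digit (8 ^ k * (8 * u)) = digit (8 ^ k * (8 * v))" if "k < n" for k
      using Suc.prems[of "Suc k"] that by (simp add: mult_ac)
    then have IH: "\<bar>frac (8 * u) - frac (8 * v)\<bar> \<le> (1/8) ^ n" "\<bar>skew (8 * u) - skew (8 * v)\<bar> \<le> (1/4) ^ n"
      using Suc.IH by auto
    have "digit u = digit v" using Suc.prems[of 0] by simp
    then have "frac u - frac v = (frac (8 * u) - frac (8 * v)) / 8"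
      using frac_via_digit[of u] frac_via_digit[of v] by (simp add: field_simps)
    then have "\<bar>frac u - frac v\<bar> = \<bar>frac (8 * u) - frac (8 * v)\<bar> / 8" by (simp only: abs_divide abs_numeral)
    also have "\<dots> \<le> (1/8) ^ n / 8" using IH(1) by (rule divide_right_mono) simp
    finally have 1: "\<bar>frac u - frac v\<bar> \<le> (1/8) ^ Suc n" by simp
    have "skew u - skew v = ((skew (8 * u) - skew (8 * v)) - (frac u - frac v)) / 8"
      using skew_times_8[of u] skew_times_8[of v] by simp
    then have "\<bar>skew u - skew v\<bar> = \<bar>(skew (8 * u) - skew (8 * v)) - (frac u - frac v)\<bar> / 8"
      by (simp only: abs_divide abs_numeral)
    also have "\<dots> \<le> ((1/4) ^ n + (1/4) ^ Suc n) / 8"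
    proof (rule divide_right_mono)
      have "(1/8::real) ^ Suc n \<le> (1/4) ^ Suc n" by (rule power_mono) auto
      then show "\<bar>(skew (8 * u) - skew (8 * v)) - (frac u - frac v)\<bar> \<le> (1/4) ^ n + (1/4) ^ Suc n"
        using 1 IH(2) by (meson abs_triangle_ineq4 add_mono order_trans)
    qed simp
    also have "\<dots> \<le> (1/4) ^ Suc n" by simp
    finally have "\<bar>skew u - skew v\<bar> \<le> (1/4) ^ Suc n" .
    then show ?case using 1 by blast
  qed
  then show "\<bar>frac u - frac v\<bar> \<le> (1/8) ^ n" "\<bar>skew u - skew v\<bar> \<le> (1/4) ^ n" by auto
qed

lemma eventually_digit_irrational:
  assumes "u \<notin> \<rat>" "(h \<longlongrightarrow> u) F"
  shows "\<forall>\<^sub>F z in F. digit (h z) = digit u"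
proof -
  have irr: "8 * u \<notin> \<int>" "u \<notin> \<int>"
  proof -
    have "u = 8 * u / 8" by simp
    then show "8 * u \<notin> \<int>" using assms(1) Ints_subset_Rats by (metis Rats_divide Rats_number_of subsetD)
    show "u \<notin> \<int>" using assms(1) Ints_subset_Rats by blast
  qed
  have "\<forall>\<^sub>F z in F. \<lfloor>8 * h z\<rfloor> = \<lfloor>8 * u\<rfloor>" "\<forall>\<^sub>F z in F. \<lfloor>h z\<rfloor> = \<lfloor>u\<rfloor>"
    using irr assms(2) by (auto intro!: eventually_floor_eq tendsto_intros)
  then show ?thesis by eventually_elim (simp add: digit_def)
qed

lemma eventually_floor_right: "\<forall>\<^sub>F v in at_right u. \<lfloor>c * v\<rfloor> = \<lfloor>c * u\<rfloor>" if c: "c > 0" for c u :: real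
proof -
  have "((\<lambda>v. c * v) \<longlongrightarrow> c * u) (at_right u)" by (intro tendsto_intros)
  then have "\<forall>\<^sub>F v in at_right u. c * v < of_int \<lfloor>c * u\<rfloor> + 1"
    by (rule order_tendstoD) linarith
  moreover have "\<forall>\<^sub>F v in at_right u. u < v" by (rule eventually_at_right_less)
  ultimately show ?thesis
  proof eventually_elim
    case (elim v)
    then have "c * u < c * v" using c by simp
    then show ?case using elim by linarith
  qed
qed

lemma eventually_digit_right: "\<forall>\<^sub>F v in at_right u. digit (8 ^ k * v) = digit (8 ^ k * u)"
proof -
  have "\<forall>\<^sub>F v in at_right u. \<lfloor>8 * 8 ^ k * v\<rfloor> = \<lfloor>8 * 8 ^ k * u\<rfloor>" "\<forall>\<^sub>F v in at_right u. \<lfloor>8 ^ k * v\<rfloor> = \<lfloor>8 ^ k * u\<rfloor>"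
    by (rule eventually_floor_right; simp)+
  then show ?thesis by eventually_elim (simp add: digit_def mult.assoc)
qed

lemma power_8_irrational: "u \<notin> \<rat> \<Longrightarrow> 8 ^ k * u \<notin> \<rat>" for u :: real
proof
  assume "u \<notin> \<rat>" "8 ^ k * u \<in> \<rat>"
  then have "8 ^ k * u / 8 ^ k \<in> \<rat>" by (intro Rats_divide Rats_power) auto
  then show False using \<open>u \<notin> \<rat>\<close> by simp
qed

text \<open>
  Near an irrational number the first \<open>n\<close> digits are constant, so \<open>skew\<close> varies by at most \<open>(1/4)\<^sup>n\<close>.
\<close>
lemma tendsto_skew_irrational:
  assumes "u \<notin> \<rat>"
  shows "(skew \<longlongrightarrow> skew u) (nhds u)"
proof (rule tendstoI)
  fix e :: real assume "e > 0"
  then obtain n where n: "(1/4::real) ^ n < e" using real_arch_pow_inv[of e "1/4"] by auto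
  have "\<forall>\<^sub>F v in nhds u. \<forall>k\<in>{..<n}. digit (8 ^ k * v) = digit (8 ^ k * u)"
    by (intro eventually_ball_finite ballI eventually_digit_irrational power_8_irrational assms tendsto_intros filterlim_ident) auto
  then show "\<forall>\<^sub>F v in nhds u. dist (skew v) (skew u) < e"
  proof eventually_elim
    case (elim v)
    then have "\<bar>skew v - skew u\<bar> \<le> (1/4) ^ n" by (intro equal_digits_close(2)) auto
    then show ?case using n by (simp add: dist_real_def)
  qed
qed

definition height :: "real ^ 2 \<Rightarrow> real" where
  "height x = x $ 1 - skew (x $ 2)"

text \<open>
  The cell of a point is given by the first digits of its two straightened coordinates. Codes along an orbit are
  then the further digits of these coordinates.
\<close>
definition code :: "real ^ 2 \<Rightarrow> int \<times> int" where
  "code x = (digit (height x), digit (x $ 2))"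

text \<open>
  Points at which neither the digits nor the skewing function jump. They are dense, invariant under the map, and
  interior to their cell.
\<close>
definition generic :: "real ^ 2 \<Rightarrow> bool" where
  "generic x \<longleftrightarrow> height x \<notin> \<rat> \<and> x $ 2 \<notin> \<rat>"

text \<open>
  The half-open cells, which form a partition of the torus into sets that are mapped bijectively onto the
  torus; the members of the Markov partition are their closures.
\<close>
definition tile :: "int \<times> int \<Rightarrow> 2 torus set" where
  "tile i = torus_proj ` {x. code x = i}"

definition tiling :: "2 torus set set" where
  "tiling = range (\<lambda>x. closure (tile (code x)))"

lemma height_diff_Ints:
  assumes "torus_proj x = torus_proj y"
  shows "height x - height y \<in> \<int>"
proof -
  have "skew (x $ 2) = skew (y $ 2)" using assms by (intro skew_cong) (simp add: torus_proj_eq_iff)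
  then show ?thesis using assms by (simp add: height_def torus_proj_eq_iff)
qed

lemma code_cong:
  assumes "torus_proj x = torus_proj y"
  shows "code x = code y"
proof -
  have "digit (height x) = digit (height y)" by (rule digit_cong[OF height_diff_Ints[OF assms]])
  moreover have "digit (x $ 2) = digit (y $ 2)"
    using assms by (intro digit_cong) (simp add: torus_proj_eq_iff)
  ultimately show ?thesis by (simp add: code_def)
qed

lemma torus_proj_in_tile [simp]: "torus_proj x \<in> tile i \<longleftrightarrow> code x = i"
proof
  assume "torus_proj x \<in> tile i"
  then obtain y where "torus_proj x = torus_proj y" "code y = i" unfolding tile_def by blast
  then show "code x = i" using code_cong[of x y] by simp
next
  assume "code x = i"
  then show "torus_proj x \<in> tile i" unfolding tile_def by blast
qed

lemma height_linear_lift: "height (linear_lift shear_matrix x) = 8 * height x + of_int \<lfloor>x $ 2\<rfloor>"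
  by (simp add: height_def shear_matrix_lift skew_times_8 frac_def)

lemma generic_linear_lift:
  assumes "generic x"
  shows "generic (linear_lift shear_matrix x)"
proof -
  have "8 * height x + of_int \<lfloor>x $ 2\<rfloor> \<notin> \<rat>"
  proof
    assume "8 * height x + of_int \<lfloor>x $ 2\<rfloor> \<in> \<rat>"
    then have "8 * height x + of_int \<lfloor>x $ 2\<rfloor> - of_int \<lfloor>x $ 2\<rfloor> \<in> \<rat>" by (intro Rats_diff) auto
    then show False using assms power_8_irrational[of "height x" 1] by (simp add: generic_def)
  qed
  then show ?thesis
    using assms power_8_irrational[of "x $ 2" 1]
    unfolding generic_def height_linear_lift shear_matrix_lift by simp
qed

lemma code_linear_lift: "code (linear_lift shear_matrix x) = (digit (8 * height x), digit (8 * x $ 2))"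
proof -
  have "digit (8 * height x + of_int \<lfloor>x $ 2\<rfloor>) = digit (8 * height x)" by (rule digit_cong) simp
  then show ?thesis unfolding code_def height_linear_lift shear_matrix_lift by simp
qed

lemma linear_lift_funpow_coordinates:
  "height ((linear_lift shear_matrix ^^ k) x) - 8 ^ k * height x \<in> \<int>"
  "(linear_lift shear_matrix ^^ k) x $ 2 = 8 ^ k * x $ 2"
proof (induction k)
  case (Suc k)
  let ?y = "(linear_lift shear_matrix ^^ k) x"
  case 1
  have "height ((linear_lift shear_matrix ^^ Suc k) x) - 8 ^ Suc k * height x
      = 8 * (height ?y - 8 ^ k * height x) + of_int \<lfloor>?y $ 2\<rfloor>"
    by (simp add: height_linear_lift algebra_simps)
  moreover have "\<dots> \<in> \<int>" using Suc by (intro Ints_add Ints_mult) auto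
  ultimately show ?case by (simp only:)
  case 2
  then show ?case using Suc by (simp add: shear_matrix_lift)
qed simp_all

lemma code_funpow:
  "code ((linear_lift shear_matrix ^^ k) x) = (digit (8 ^ k * height x), digit (8 ^ k * x $ 2))"
  unfolding code_def linear_lift_funpow_coordinates(2)
  using digit_cong[OF linear_lift_funpow_coordinates(1)] by simp

text \<open>
  Points with the same itinerary of length \<open>n\<close> have straightened coordinates with the same \<open>n\<close> digits; the lift
  \<open>z\<close> is chosen to have the same integer parts as \<open>x\<close>.
\<close>
lemma equal_codes_close:
  assumes "\<And>k. k < n \<Longrightarrow> code ((linear_lift shear_matrix ^^ k) x) = code ((linear_lift shear_matrix ^^ k) y)"
  obtains z where "torus_proj z = torus_proj y" "\<bar>x $ 1 - z $ 1\<bar> \<le> (1/4) ^ n + (1/8) ^ n" "\<bar>x $ 2 - z $ 2\<bar> \<le> (1/8) ^ n"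
proof -
  have d: "digit (8 ^ k * height x) = digit (8 ^ k * height y)" "digit (8 ^ k * x $ 2) = digit (8 ^ k * y $ 2)"
    if "k < n" for k
    using assms[OF that] unfolding code_funpow by auto
  define z :: "real ^ 2" where "z = vector [x $ 1 - (frac (height x) - frac (height y)) - (skew (x $ 2) - skew (y $ 2)),
      x $ 2 - (frac (x $ 2) - frac (y $ 2))]"
  have "z $ 1 - y $ 1 = of_int (\<lfloor>height x\<rfloor> - \<lfloor>height y\<rfloor>)"
    by (simp add: z_def frac_def height_def)
  moreover have "z $ 2 - y $ 2 = of_int (\<lfloor>x $ 2\<rfloor> - \<lfloor>y $ 2\<rfloor>)"
    by (simp add: z_def frac_def)
  ultimately have "torus_proj z = torus_proj y" unfolding torus_proj_eq_iff forall_2 by (metis Ints_of_int)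
  moreover have "\<bar>x $ 1 - z $ 1\<bar> \<le> (1/4) ^ n + (1/8) ^ n"
  proof -
    have "\<bar>frac (height x) - frac (height y)\<bar> \<le> (1/8) ^ n"
      by (rule equal_digits_close(1)) (rule d(1))
    moreover have "\<bar>skew (x $ 2) - skew (y $ 2)\<bar> \<le> (1/4) ^ n"
      by (rule equal_digits_close(2)) (rule d(2))
    moreover have "x $ 1 - z $ 1 = (frac (height x) - frac (height y)) + (skew (x $ 2) - skew (y $ 2))"
      by (simp add: z_def)
    ultimately show ?thesis by linarith
  qed
  moreover have "\<bar>x $ 2 - z $ 2\<bar> \<le> (1/8) ^ n"
  proof -
    have "\<bar>frac (x $ 2) - frac (y $ 2)\<bar> \<le> (1/8) ^ n"
      by (rule equal_digits_close(1)) (rule d(2))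
    then show ?thesis by (simp add: z_def)
  qed
  ultimately show ?thesis using that by blast
qed

lemma dist_le_l1: "dist x y \<le> \<bar>x $ 1 - y $ 1\<bar> + \<bar>x $ 2 - y $ 2\<bar>" for x y :: "real ^ 2"
  using norm_le_l1_cart[of "x - y"] by (simp add: dist_norm sum_2)

lemma generic_in_box:
  assumes "a1 < b1" "a2 < b2"
  obtains x where "generic x" "a1 < x $ 1" "x $ 1 < b1" "a2 < x $ 2" "x $ 2 < b2"
proof -
  obtain v where v: "a2 < v" "v < b2" "v \<notin> \<rat>" using irrational_between[OF assms(2)] .
  have "a1 - skew v < b1 - skew v" using assms(1) by simp
  then obtain r where r: "a1 - skew v < r" "r < b1 - skew v" "r \<notin> \<rat>" using irrational_between by blast
  show ?thesis
    by (rule that[of "vector [r + skew v, v]"]) (use v r in \<open>auto simp: generic_def height_def\<close>)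
qed

lemma generic_in_open:
  assumes "open U" "p \<in> U"
  obtains x where "generic x" "torus_proj x \<in> U"
proof -
  obtain y where y: "torus_proj y = p" using torus_proj_surj by blast
  then obtain e where e: "e > 0" "ball y e \<subseteq> torus_proj -` U"
    using open_vimage_torus_proj[OF assms(1)] assms(2) openE[of "torus_proj -` U" y] by auto
  obtain x where x: "generic x" "y $ 1 - e / 2 < x $ 1" "x $ 1 < y $ 1 + e / 2" "y $ 2 - e / 2 < x $ 2" "x $ 2 < y $ 2 + e / 2"
    using generic_in_box[of "y $ 1 - e / 2" "y $ 1 + e / 2" "y $ 2 - e / 2" "y $ 2 + e / 2"] e(1) by auto
  have "dist y x < e" using dist_le_l1[of y x] x by linarith
  then show ?thesis using that[OF x(1)] e(2) by (auto simp: subset_iff)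
qed

text \<open>
  Digits are continuous from the right. Moving both straightened coordinates slightly to the right, to
  irrational values, preserves the code and changes \<open>skew\<close> only a little.
\<close>
lemma generic_approximation_with_same_code:
  assumes "e > 0"
  obtains y where "generic y" "code y = code x" "dist x y < e"
proof -
  obtain n where n: "(1/4::real) ^ n < e / 4" using real_arch_pow_inv[of "e / 4" "1/4"] assms by auto
  have "\<forall>\<^sub>F v in at_right (x $ 2). \<forall>k\<in>{..n}. digit (8 ^ k * v) = digit (8 ^ k * x $ 2)"
    by (intro eventually_ball_finite ballI eventually_digit_right) auto
  moreover have "\<forall>\<^sub>F v in at_right (x $ 2). v < x $ 2 + e / 4"
    unfolding eventually_at_right_field using assms by (intro exI[of _ "x $ 2 + e / 4"]) auto
  ultimately have "\<forall>\<^sub>F v in at_right (x $ 2). (\<forall>k\<in>{..n}. digit (8 ^ k * v) = digit (8 ^ k * x $ 2)) \<and> v < x $ 2 + e / 4"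
    by (rule eventually_conj)
  then obtain b where b: "b > x $ 2" "\<And>v. x $ 2 < v \<Longrightarrow> v < b \<Longrightarrow> (\<forall>k\<in>{..n}. digit (8 ^ k * v) = digit (8 ^ k * x $ 2)) \<and> v < x $ 2 + e / 4"
    unfolding eventually_at_right_field by blast
  obtain v where v: "x $ 2 < v" "v < b" "v \<notin> \<rat>" using irrational_between[OF b(1)] .
  have "\<forall>\<^sub>F r in at_right (height x). digit r = digit (height x)"
    using eventually_digit_right[of 0 "height x"] by simp
  moreover have "\<forall>\<^sub>F r in at_right (height x). r < height x + e / 4"
    unfolding eventually_at_right_field using assms by (intro exI[of _ "height x + e / 4"]) auto
  ultimately have "\<forall>\<^sub>F r in at_right (height x). digit r = digit (height x) \<and> r < height x + e / 4"
    by (rule eventually_conj)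
  then obtain b' where b': "b' > height x" "\<And>r. height x < r \<Longrightarrow> r < b' \<Longrightarrow> digit r = digit (height x) \<and> r < height x + e / 4"
    unfolding eventually_at_right_field by blast
  obtain r where r: "height x < r" "r < b'" "r \<notin> \<rat>" using irrational_between[OF b'(1)] .
  have "\<bar>skew v - skew (x $ 2)\<bar> \<le> (1/4) ^ n"
    using b(2)[OF v(1,2)] by (intro equal_digits_close(2)) auto
  define y :: "real ^ 2" where "y = vector [r + skew v, v]"
  have "generic y" using v r by (simp add: y_def generic_def height_def)
  moreover have "code y = code x"
    using b(2)[OF v(1,2)] b'(2)[OF r(1,2)] by (auto simp: y_def code_def height_def dest: bspec[of _ _ 0])
  moreover have "dist x y < e"
  proof -
    have "\<bar>x $ 2 - y $ 2\<bar> < e / 4" using b(2)[OF v(1,2)] v(1) by (simp add: y_def)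
    moreover have "x $ 1 - y $ 1 = (height x - r) - (skew v - skew (x $ 2))"
      by (simp add: y_def height_def)
    then have "\<bar>x $ 1 - y $ 1\<bar> < e / 2"
      using b'(2)[OF r(1,2)] r(1) n \<open>\<bar>skew v - skew (x $ 2)\<bar> \<le> (1/4) ^ n\<close> by linarith
    ultimately show ?thesis using dist_le_l1[of x y] assms by linarith
  qed
  ultimately show ?thesis using that by blast
qed

lemma generic_in_interior_tile:
  assumes "generic x"
  shows "torus_proj x \<in> interior (tile (code x))"
proof -
  have t2: "((\<lambda>z. z $ 2) \<longlongrightarrow> x $ 2) (nhds x)" and t1: "((\<lambda>z. z $ 1) \<longlongrightarrow> x $ 1) (nhds x)"
    by (intro tendsto_vec_nth filterlim_ident)+
  have "((\<lambda>z. skew (z $ 2)) \<longlongrightarrow> skew (x $ 2)) (nhds x)"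
    using filterlim_compose[OF tendsto_skew_irrational t2] assms by (simp add: generic_def)
  then have "(height \<longlongrightarrow> height x) (nhds x)"
    unfolding height_def by (intro tendsto_diff t1)
  then have "\<forall>\<^sub>F z in nhds x. digit (height z) = digit (height x)" "\<forall>\<^sub>F z in nhds x. digit (z $ 2) = digit (x $ 2)"
    using assms t2 by (auto simp: generic_def intro: eventually_digit_irrational)
  then have "\<forall>\<^sub>F z in nhds x. code z = code x" by eventually_elim (simp add: code_def)
  then obtain d where d: "d > 0" "\<And>z. dist z x < d \<Longrightarrow> code z = code x"
    unfolding eventually_nhds_metric by blast
  have "ball (torus_proj x) d \<subseteq> tile (code x)"
  proof
    fix q assume "q \<in> ball (torus_proj x) d"
    then have "d - dist (torus_proj x) q > 0" by simp
    then obtain z where "torus_proj z = q" "dist x z < dist (torus_proj x) q + (d - dist (torus_proj x) q)"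
      by (rule torus_proj_lift_near)
    then show "q \<in> tile (code x)" using d(2)[of z] by (auto simp: dist_commute)
  qed
  then show ?thesis using d(1) by (meson mem_interior)
qed

text \<open>
  A generic point has a neighbourhood inside its own tile, and tiles are disjoint.
\<close>
lemma generic_in_closure_tile:
  assumes "generic x" "torus_proj x \<in> closure (tile i)"
  shows "code x = i"
proof -
  have "interior (tile (code x)) \<inter> tile i \<noteq> {}"
    using generic_in_interior_tile[OF assms(1)] assms(2) open_Int_closure_eq_empty[OF open_interior] by blast
  then obtain q where q: "q \<in> interior (tile (code x))" "q \<in> tile i" by blast
  then obtain y where "q = torus_proj y" "code y = i" unfolding tile_def by blast
  then show ?thesis using subsetD[OF interior_subset q(1)] by simp
qed

lemma tile_subset_closure_interior: "tile i \<subseteq> closure (interior (tile i))"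
proof
  fix p assume "p \<in> tile i"
  then obtain x where x: "p = torus_proj x" "code x = i" unfolding tile_def by blast
  show "p \<in> closure (interior (tile i))"
    unfolding closure_approachable
  proof (intro allI impI)
    fix e :: real assume "e > 0"
    then obtain y where y: "generic y" "code y = code x" "dist x y < e"
      using generic_approximation_with_same_code by blast
    have "torus_proj y \<in> interior (tile i)" using generic_in_interior_tile[OF y(1)] y(2) x(2) by simp
    moreover have "dist (torus_proj y) p < e"
      using dist_torus_le[of y x] y(3) x(1) by (simp add: dist_commute)
    ultimately show "\<exists>y\<in>interior (tile i). dist y p < e" by blast
  qed
qed

lemma finite_tiling: "finite tiling"
proof -
  have "tiling \<subseteq> (\<lambda>i. closure (tile i)) ` ({0..7} \<times> {0..7})"
    unfolding tiling_def code_def using digit_bounds by force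
  then show ?thesis by (rule finite_subset) simp
qed

lemma proper_set_closure_tile: "proper_set (closure (tile (code x)))"
  unfolding proper_set_def
proof
  let ?T = "tile (code x)"
  have "?T \<subseteq> closure (interior (closure ?T))"
    using tile_subset_closure_interior[of "code x"] closure_mono[OF interior_mono[OF closure_subset[of ?T]]] by (rule order_trans)
  then have "closure ?T \<subseteq> closure (interior (closure ?T))" by (rule closure_minimal) simp
  moreover have "closure (interior (closure ?T)) \<subseteq> closure ?T"
    by (rule closure_minimal[OF interior_subset]) simp
  ultimately show "closure ?T = closure (interior (closure ?T))" by (rule subset_antisym)
  have "torus_proj x \<in> ?T" by simp
  then show "closure ?T \<noteq> {}" using closure_subset[of ?T] by blast
qed

lemma interior_closure_tile_disjoint:
  assumes "i \<noteq> j"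
  shows "interior (closure (tile i)) \<inter> interior (closure (tile j)) = {}"
proof (rule ccontr)
  assume "\<not> ?thesis"
  then obtain p where p: "p \<in> interior (closure (tile i)) \<inter> interior (closure (tile j))" by blast
  obtain x where x: "generic x" "torus_proj x \<in> interior (closure (tile i)) \<inter> interior (closure (tile j))"
    using generic_in_open[OF open_Int[OF open_interior open_interior] p] .
  then have "torus_proj x \<in> closure (tile i)" "torus_proj x \<in> closure (tile j)"
    using interior_subset by blast+
  then have "code x = i" "code x = j" using generic_in_closure_tile[OF x(1)] by blast+
  then show False using assms by simp
qed

lemma generic_funpow: "generic x \<Longrightarrow> generic ((linear_lift shear_matrix ^^ k) x)"
  by (induction k) (auto intro: generic_linear_lift)

text \<open>
  The points that follow a given itinerary for \<open>n\<close> steps form an open set, in which generic points are dense. Their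
  codes are the prescribed ones, so the set has diameter of order \<open>(1/4)\<^sup>n\<close>.
\<close>
lemma tiling_metrically_generating:
  assumes X: "\<And>k. X k \<in> tiling"
    and p: "\<And>k. (toral_endomorphism shear_matrix ^^ k) p \<in> interior (X k)"
    and q: "\<And>k. (toral_endomorphism shear_matrix ^^ k) q \<in> interior (X k)"
  shows "p = q"
proof -
  let ?f = "toral_endomorphism shear_matrix" and ?F = "linear_lift shear_matrix"
  have "\<exists>i. X k = closure (tile i)" for k using X[of k] unfolding tiling_def by blast
  then obtain i where i: "\<And>k. X k = closure (tile (i k))" by metis
  have "dist p q \<le> 5 * (1/4) ^ n" for n
  proof -
    define V where "V = (\<Inter>k\<in>{..<n}. (?f ^^ k) -` interior (X k))"
    have "open V" unfolding V_def
      by (intro open_INT ballI open_vimage continuous_on_funpow_toral_endomorphism) auto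
    have code: "code ((?F ^^ k) x) = i k" if x: "generic x" "torus_proj x \<in> V" and k: "k < n" for x k
    proof (rule generic_in_closure_tile[OF generic_funpow[OF x(1)]])
      have "(?f ^^ k) (torus_proj x) \<in> interior (X k)" using x(2) k unfolding V_def by blast
      then show "torus_proj ((?F ^^ k) x) \<in> closure (tile (i k))"
        unfolding toral_endomorphism_funpow_proj i using interior_subset by blast
    qed
    have near: "\<exists>x. generic x \<and> torus_proj x \<in> V \<and> dist r (torus_proj x) < (1/4) ^ n" if "r \<in> V" for r
    proof -
      have "r \<in> V \<inter> ball r ((1/4) ^ n)" using that by simp
      then obtain x where "generic x" "torus_proj x \<in> V \<inter> ball r ((1/4) ^ n)"
        using generic_in_open[OF open_Int[OF \<open>open V\<close> open_ball]] by blast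
      then show ?thesis by auto
    qed
    have "p \<in> V" "q \<in> V" using p q unfolding V_def by auto
    then obtain x y where x: "generic x" "torus_proj x \<in> V" "dist p (torus_proj x) < (1/4) ^ n"
      and y: "generic y" "torus_proj y \<in> V" "dist q (torus_proj y) < (1/4) ^ n"
      using near by meson
    have "code ((?F ^^ k) x) = code ((?F ^^ k) y)" if "k < n" for k
      using code[OF x(1,2) that] code[OF y(1,2) that] by simp
    then obtain z where z: "torus_proj z = torus_proj y" "\<bar>x $ 1 - z $ 1\<bar> \<le> (1/4) ^ n + (1/8) ^ n" "\<bar>x $ 2 - z $ 2\<bar> \<le> (1/8) ^ n"
      using equal_codes_close by blast
    have "(1/8::real) ^ n \<le> (1/4) ^ n" by (rule power_mono) auto
    then have "dist (torus_proj x) (torus_proj y) \<le> 3 * (1/4) ^ n"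
      using dist_torus_le[of x z] dist_le_l1[of x z] z by simp
    then show ?thesis
      using x(3) y(3) dist_triangle[of p q "torus_proj x"] dist_triangle[of "torus_proj x" q "torus_proj y"]
      by (simp add: dist_commute)
  qed
  then have "\<exists>N. \<forall>n\<ge>N. dist p q \<le> 5 * (1/4) ^ n" by blast
  moreover have "(\<lambda>n. 5 * (1/4::real) ^ n) \<longlonglongrightarrow> 5 * 0"
    by (intro tendsto_mult tendsto_const LIMSEQ_power_zero) simp
  ultimately have "dist p q \<le> 5 * 0" using LIMSEQ_le_const by blast
  then show "p = q" by simp
qed

text \<open>
  Prepend the digits of \<open>w\<close> to the base 8 expansions of the straightened coordinates of \<open>u\<close>.
\<close>
lemma tile_onto:
  obtains x where "code x = code w" "torus_proj (linear_lift shear_matrix x) = torus_proj u"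
proof -
  define y2 where "y2 = (of_int (digit (w $ 2)) + frac (u $ 2)) / 8"
  define r where "r = (of_int (digit (height w)) + frac (height u)) / 8"
  define x :: "real ^ 2" where "x = vector [r + skew y2, y2]"
  have dig: "digit ((of_int d + frac t) / 8) = d" if "0 \<le> d" "d \<le> 7" for d :: int and t :: real
  proof -
    have "0 \<le> real_of_int d" "real_of_int d \<le> 7" using that by simp_all
    then have "0 \<le> (of_int d + frac t) / 8" "(of_int d + frac t) / 8 < 1"
      using frac_ge_0[of t] frac_lt_1[of t] by auto
    then have "8 * frac ((of_int d + frac t) / 8) = of_int d + frac t" by simp
    then show ?thesis unfolding digit_eq using frac_ge_0[of t] frac_lt_1[of t] by (simp add: floor_eq_iff)
  qed
  have hx: "height x = r" by (simp add: height_def x_def)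
  have "code x = code w"
    unfolding code_def hx using digit_bounds by (simp add: x_def y2_def r_def dig)
  moreover have "torus_proj (linear_lift shear_matrix x) = torus_proj u"
  proof -
    let ?y = "linear_lift shear_matrix x"
    have "?y $ 2 - u $ 2 = of_int (digit (w $ 2) - \<lfloor>u $ 2\<rfloor>)"
      unfolding shear_matrix_lift x_def y2_def frac_def by (simp add: field_simps)
    then have 2: "?y $ 2 - u $ 2 \<in> \<int>" by (metis Ints_of_int)
    have "height ?y - height u = of_int (digit (height w) - \<lfloor>height u\<rfloor> + \<lfloor>x $ 2\<rfloor>)"
      unfolding height_linear_lift hx r_def frac_def by (simp add: field_simps)
    then have "height ?y - height u \<in> \<int>" by (metis Ints_of_int)
    moreover have "?y $ 1 - u $ 1 = height ?y - height u"
      using skew_cong[OF 2] by (simp add: height_def)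
    ultimately show ?thesis using 2 by (simp add: torus_proj_eq_iff forall_2)
  qed
  ultimately show ?thesis using that by blast
qed

lemma shear_matrix_close_preimages_equal:
  assumes "torus_proj (linear_lift shear_matrix x) = torus_proj (linear_lift shear_matrix y)"
    and "\<bar>x $ 1 - y $ 1\<bar> < 1/8" "\<bar>x $ 2 - y $ 2\<bar> < 1/8"
  shows "x = y"
proof -
  have "8 * x $ 2 - 8 * y $ 2 \<in> \<int>"
    using assms(1) unfolding torus_proj_eq_iff forall_2 shear_matrix_lift by blast
  moreover have "\<bar>8 * x $ 2 - 8 * y $ 2\<bar> < 1" using assms(3) by linarith
  ultimately have 2: "8 * x $ 2 - 8 * y $ 2 = 0" using Ints_nonzero_abs_less1 by blast
  then have 22: "x $ 2 = y $ 2" by simp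
  have "8 * x $ 1 + x $ 2 - (8 * y $ 1 + y $ 2) \<in> \<int>"
    using assms(1) unfolding torus_proj_eq_iff forall_2 shear_matrix_lift by blast
  then have "8 * x $ 1 - 8 * y $ 1 \<in> \<int>" using 22 by simp
  moreover have "\<bar>8 * x $ 1 - 8 * y $ 1\<bar> < 1" using assms(2) by linarith
  ultimately have "8 * x $ 1 - 8 * y $ 1 = 0" using Ints_nonzero_abs_less1 by blast
  then show ?thesis using 22 by (simp add: vec_eq_iff forall_2)
qed

text \<open>
  Both points are limits of generic points of the tile \<open>i\<close> whose images lie in the tile \<open>j\<close>. Such generic points
  share two codes, so they are at most \<open>5/64\<close> apart in each coordinate, whereas two preimages of one point
  differ by at least \<open>1/8\<close> in some coordinate.
\<close>
lemma tiling_unique_preimage: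
  assumes p: "p \<in> closure (tile i)" and p': "p' \<in> closure (tile i)"
    and eq: "toral_endomorphism shear_matrix p = toral_endomorphism shear_matrix p'"
    and int: "toral_endomorphism shear_matrix p \<in> interior (closure (tile j))"
  shows "p = p'"
proof -
  let ?f = "toral_endomorphism shear_matrix" and ?F = "linear_lift shear_matrix"
  define V where "V = ?f -` interior (closure (tile j))"
  have "open V" unfolding V_def by (intro open_vimage continuous_on_toral_endomorphism) auto
  have near: "\<exists>x. code x = i \<and> code (?F x) = j \<and> dist (torus_proj x) r < 1/64"
    if r: "r \<in> closure (tile i)" "r \<in> V" for r
  proof -
    have "closure (tile i) \<subseteq> closure (interior (tile i))"
      by (rule closure_minimal[OF tile_subset_closure_interior]) simp
    then have "r \<in> closure (interior (tile i))" using r(1) by blast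
    moreover have op: "open (V \<inter> ball r (1/64))" using \<open>open V\<close> by auto
    moreover have "r \<in> V \<inter> ball r (1/64)" using r(2) by simp
    ultimately have "V \<inter> ball r (1/64) \<inter> interior (tile i) \<noteq> {}"
      using open_Int_closure_eq_empty[OF op, of "interior (tile i)"] by blast
    then obtain s where s: "s \<in> V \<inter> ball r (1/64) \<inter> interior (tile i)" by blast
    obtain x where x: "generic x" "torus_proj x \<in> V \<inter> ball r (1/64) \<inter> interior (tile i)"
      using generic_in_open[OF open_Int[OF op open_interior] s] .
    have "torus_proj x \<in> tile i" using x(2) interior_subset by blast
    then have "code x = i" by simp
    moreover have "torus_proj (?F x) \<in> interior (closure (tile j))"
      using x(2) unfolding V_def by (simp add: toral_endomorphism_proj)
    then have "code (?F x) = j"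
      using generic_in_closure_tile[OF generic_linear_lift[OF x(1)]] interior_subset by blast
    moreover have "dist (torus_proj x) r < 1/64" using x(2) by (simp add: dist_commute)
    ultimately show ?thesis by blast
  qed
  have "p \<in> V" "p' \<in> V" using int eq unfolding V_def by simp_all
  then obtain x x' where x: "code x = i" "code (?F x) = j" "dist (torus_proj x) p < 1/64"
    and x': "code x' = i" "code (?F x') = j" "dist (torus_proj x') p' < 1/64"
    using near[OF p] near[OF p'] by blast
  have "code ((?F ^^ k) x) = code ((?F ^^ k) x')" if "k < 2" for k
    using that x x' by (auto simp: less_Suc_eq numeral_2_eq_2)
  then obtain z where z: "torus_proj z = torus_proj x'" "\<bar>x $ 1 - z $ 1\<bar> \<le> (1/4)\<^sup>2 + (1/8)\<^sup>2" "\<bar>x $ 2 - z $ 2\<bar> \<le> (1/8)\<^sup>2"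
    using equal_codes_close by blast
  have lift: "\<exists>P. torus_proj P = r \<and> \<bar>y $ 1 - P $ 1\<bar> < 1/64 \<and> \<bar>y $ 2 - P $ 2\<bar> < 1/64"
    if "dist (torus_proj y) r < 1/64" for y :: "real ^ 2" and r
  proof -
    have "1/64 - dist (torus_proj y) r > 0" using that by simp
    then obtain P where P: "torus_proj P = r" "dist y P < dist (torus_proj y) r + (1/64 - dist (torus_proj y) r)"
      by (rule torus_proj_lift_near)
    have "\<bar>y $ k - P $ k\<bar> < 1/64" for k
      using P(2) component_le_norm_cart[of "y - P" k] by (simp add: dist_norm)
    then show ?thesis using P(1) by blast
  qed
  obtain P where P: "torus_proj P = p" "\<bar>x $ 1 - P $ 1\<bar> < 1/64" "\<bar>x $ 2 - P $ 2\<bar> < 1/64"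
    using lift[OF x(3)] by blast
  obtain P' where P': "torus_proj P' = p'" "\<bar>z $ 1 - P' $ 1\<bar> < 1/64" "\<bar>z $ 2 - P' $ 2\<bar> < 1/64"
    using lift[of z p'] x'(3) z(1) by auto
  have "P = P'"
  proof (rule shear_matrix_close_preimages_equal)
    show "torus_proj (?F P) = torus_proj (?F P')"
      using eq P(1) P'(1) by (simp add: toral_endomorphism_proj[symmetric])
    have "(1/4::real)\<^sup>2 = 1/16" "(1/8::real)\<^sup>2 = 1/64" by (simp_all add: power2_eq_square)
    then show "\<bar>P $ 1 - P' $ 1\<bar> < 1/8" "\<bar>P $ 2 - P' $ 2\<bar> < 1/8"
      using z(2,3) P(2,3) P'(2,3) by linarith+
  qed
  then show ?thesis using P(1) P'(1) by simp
qed

lemma markov_partition_tiling: "markov_partition (toral_endomorphism shear_matrix) tiling"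
  unfolding markov_partition_def
proof (intro conjI)
  let ?f = "toral_endomorphism shear_matrix"
  show "finite tiling" by (rule finite_tiling)
  have "p \<in> \<Union>tiling" for p
  proof -
    obtain x where "torus_proj x = p" using torus_proj_surj by blast
    then have "p \<in> closure (tile (code x))" using closure_subset[of "tile (code x)"] by auto
    then show ?thesis unfolding tiling_def by blast
  qed
  then show "\<Union>tiling = UNIV" by blast
  show "\<forall>R\<in>tiling. proper_set R"
    unfolding tiling_def by (auto intro: proper_set_closure_tile)
  show "\<forall>R\<in>tiling. \<forall>R'\<in>tiling. R \<noteq> R' \<longrightarrow> interior R \<inter> interior R' = {}"
    unfolding tiling_def by (intro ballI impI, elim rangeE) (metis interior_closure_tile_disjoint)
  show "\<forall>X. (\<forall>k. X k \<in> tiling) \<longrightarrow> (\<forall>p q. p \<in> (\<Inter>k. (?f ^^ k) -` interior (X k)) \<and>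
        q \<in> (\<Inter>k. (?f ^^ k) -` interior (X k)) \<longrightarrow> p = q)"
  proof (intro allI impI, elim conjE)
    fix X :: "nat \<Rightarrow> 2 torus set" and p q
    assume "\<forall>k. X k \<in> tiling" "p \<in> (\<Inter>k. (?f ^^ k) -` interior (X k))" "q \<in> (\<Inter>k. (?f ^^ k) -` interior (X k))"
    then show "p = q" using tiling_metrically_generating[of X p q] by simp
  qed
  show "\<forall>R\<in>tiling. \<forall>R'\<in>tiling. ?f ` interior R \<inter> interior R' \<noteq> {} \<longrightarrow>
        (\<forall>y\<in>interior R'. \<exists>!x. x \<in> R \<and> ?f x = y)"
  proof (intro ballI impI)
    fix R R' y assume "R \<in> tiling" "R' \<in> tiling" and y: "y \<in> interior R'"
    then obtain w w' where R: "R = closure (tile (code w))" and R': "R' = closure (tile (code w'))"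
      unfolding tiling_def by blast
    obtain u where u: "torus_proj u = y" using torus_proj_surj by blast
    obtain x where x: "code x = code w" "torus_proj (linear_lift shear_matrix x) = torus_proj u"
      using tile_onto .
    have "torus_proj x \<in> R" unfolding R using x(1) closure_subset[of "tile (code w)"] by auto
    moreover have "?f (torus_proj x) = y" using x(2) u by (simp add: toral_endomorphism_proj)
    ultimately show "\<exists>!x. x \<in> R \<and> ?f x = y"
    proof (intro ex1I[of _ "torus_proj x"] conjI)
      fix z assume z: "z \<in> R \<and> ?f z = y"
      show "z = torus_proj x"
      proof (rule tiling_unique_preimage[where i = "code w" and j = "code w'"])
        show "z \<in> closure (tile (code w))" using z R by simp
        show "torus_proj x \<in> closure (tile (code w))" using \<open>torus_proj x \<in> R\<close> R by simp
        show "?f z = ?f (torus_proj x)" using z \<open>?f (torus_proj x) = y\<close> by simp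
        show "?f z \<in> interior (closure (tile (code w')))" using z y R' by simp
      qed
    qed
  qed
qed

text \<open>
  Generic points just above the circle have digit 0 in the second coordinate, those just below it have
  digit 7; so no neighbourhood of a point of the circle lies in a single cell.
\<close>
lemma horizontal_circle_in_boundary: "torus_proj (vector [a, 0]) \<in> partition_boundary tiling"
proof (rule ccontr)
  let ?x = "vector [a, 0] :: real ^ 2"
  assume "torus_proj ?x \<notin> partition_boundary tiling"
  then obtain R where "R \<in> tiling" and xR: "torus_proj ?x \<in> interior R"
    using Compl_partition_boundary[OF markov_partition_tiling] by blast
  then obtain i where R: "R = closure (tile i)" unfolding tiling_def by blast
  have "open (torus_proj -` interior R)" by (rule open_vimage_torus_proj) simp
  moreover have "?x \<in> torus_proj -` interior R" using xR by simp
  ultimately obtain e where e: "e > 0" "ball ?x e \<subseteq> torus_proj -` interior R" by (rule openE)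
  define d where "d = min (e / 2) (1/8)"
  have d: "d > 0" "d \<le> e / 2" "d \<le> 1/8" using e(1) by (auto simp: d_def)
  have code: "code y = i" if "generic y" "\<bar>y $ 1 - a\<bar> < d" "\<bar>y $ 2\<bar> < d" for y
  proof -
    have "dist ?x y < e" using dist_le_l1[of ?x y] that(2,3) d by (simp add: abs_minus_commute)
    then have "torus_proj y \<in> interior R" using e(2) by (auto simp: subset_iff)
    then have "torus_proj y \<in> closure (tile i)" using interior_subset R by blast
    then show ?thesis by (rule generic_in_closure_tile[OF that(1)])
  qed
  obtain y where y: "generic y" "a - d < y $ 1" "y $ 1 < a + d" "0 < y $ 2" "y $ 2 < d"
    using generic_in_box[of "a - d" "a + d" 0 d] d(1) by auto
  obtain z where z: "generic z" "a - d < z $ 1" "z $ 1 < a + d" "- d < z $ 2" "z $ 2 < 0"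
    using generic_in_box[of "a - d" "a + d" "- d" 0] d(1) by auto
  have "code y = i" using y by (intro code) auto
  moreover have "code z = i" using z by (intro code) auto
  ultimately have "digit (y $ 2) = digit (z $ 2)" by (auto simp: code_def)
  moreover have "digit (y $ 2) = 0"
  proof -
    have "\<lfloor>8 * y $ 2\<rfloor> = 0" "\<lfloor>y $ 2\<rfloor> = 0" using y(4,5) d(3) by (simp_all add: floor_eq_iff)
    then show ?thesis by (simp add: digit_def)
  qed
  moreover have "digit (z $ 2) = 7"
  proof -
    have "\<lfloor>8 * z $ 2\<rfloor> = -1" "\<lfloor>z $ 2\<rfloor> = -1" using z(4,5) d(3) by (simp_all add: floor_eq_iff)
    then show ?thesis by (simp add: digit_def)
  qed
  ultimately show False by simp
qed

lemma C1_arc_horizontal: "C1_arc ((\<lambda>s. torus_proj (s *\<^sub>R (vector [1/2, 0] :: real ^ 2))) ` {0..1})"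
  unfolding C1_arc_def
proof (intro exI conjI ballI)
  let ?v = "vector [1/2, 0] :: real ^ 2"
  let ?c = "\<lambda>s::real. torus_proj (s *\<^sub>R ?v)"
  show "inj_on ?c {0..1}"
  proof (rule inj_onI)
    fix s t :: real assume st: "s \<in> {0..1}" "t \<in> {0..1}" "?c s = ?c t"
    then have "s / 2 - t / 2 \<in> \<int>" by (simp add: torus_proj_eq_iff forall_2)
    moreover have "\<bar>s / 2 - t / 2\<bar> < 1" using st(1,2) by auto
    ultimately have "s / 2 - t / 2 = 0" using Ints_nonzero_abs_less1 by blast
    then show "s = t" by simp
  qed
  show "?c ` {0..1} = ?c ` {0..1}" ..
  show "continuous_on {0..1} (\<lambda>_. ?v)" by simp
  fix t :: real assume "t \<in> {0..1}"
  show "?v \<noteq> 0" by (simp add: vec_eq_iff forall_2)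
  show "has_torus_derivative ?c ?v t"
    unfolding has_torus_derivative_def
  proof (intro exI[of _ "\<lambda>s. s *\<^sub>R ?v"] conjI ballI refl)
    show "continuous_on {0..1} (\<lambda>s. s *\<^sub>R ?v)" by (intro continuous_intros)
    show "((\<lambda>s. s *\<^sub>R ?v) has_vector_derivative ?v) (at t within {0..1})"
      by (auto intro!: derivative_eq_intros)
  qed
qed

lemma hybrid_partition_tiling: "hybrid_partition tiling"
  unfolding hybrid_partition_def
proof (intro conjI exI)
  show "\<not> smooth_partition tiling"
    by (rule nondiagonalizable_not_smooth[OF expanding_shear_matrix markov_partition_tiling
          not_complex_diagonalizable_shear_matrix])
  show "C1_arc ((\<lambda>s. torus_proj (s *\<^sub>R (vector [1/2, 0] :: real ^ 2))) ` {0..1})"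
    by (rule C1_arc_horizontal)
  have "s *\<^sub>R (vector [1/2, 0] :: real ^ 2) = vector [s / 2, 0]" for s :: real
    by (simp add: vec_eq_iff forall_2)
  then show "(\<lambda>s. torus_proj (s *\<^sub>R (vector [1/2, 0] :: real ^ 2))) ` {0..1} \<subseteq> partition_boundary tiling"
    using horizontal_circle_in_boundary by auto
qed

theorem theorem1p3:
  shows "(\<forall>(A :: int ^ 2 ^ 2) (M :: 2 torus set set).
           expanding A \<and> markov_partition (toral_endomorphism A) M \<longrightarrow>
             ((\<exists>l m :: real. complex_eigenvalue A (of_real l) \<and> complex_eigenvalue A (of_real m) \<and>
                 l \<notin> \<rat> \<and> m \<notin> \<rat> \<and> \<bar>l\<bar> \<noteq> \<bar>m\<bar>)
               \<longrightarrow> essentially_nowhere_smooth M) \<and>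
             ((\<exists>l :: complex. complex_eigenvalue A l \<and> l \<notin> \<real> \<and> \<not> (\<exists>q\<in>\<rat>. Arg l = q * pi))
               \<longrightarrow> nowhere_differentiable M) \<and>
             (\<not> complex_diagonalizable A \<longrightarrow> \<not> smooth_partition M)) \<and>
         (\<exists>(A :: int ^ 2 ^ 2) (M :: 2 torus set set).
           expanding A \<and> \<not> complex_diagonalizable A \<and>
           markov_partition (toral_endomorphism A) M \<and> hybrid_partition M)"
proof (intro conjI allI impI)
  fix A :: "int ^ 2 ^ 2" and M :: "2 torus set set"
  assume AM: "expanding A \<and> markov_partition (toral_endomorphism A) M"
    and "\<exists>l m :: real. complex_eigenvalue A (of_real l) \<and> complex_eigenvalue A (of_real m) \<and>
           l \<notin> \<rat> \<and> m \<notin> \<rat> \<and> \<bar>l\<bar> \<noteq> \<bar>m\<bar>"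
  then obtain l m :: real where "complex_eigenvalue A (of_real l)" "complex_eigenvalue A (of_real m)"
    "l \<notin> \<rat>" "m \<notin> \<rat>" "\<bar>l\<bar> < \<bar>m\<bar> \<or> \<bar>m\<bar> < \<bar>l\<bar>"
    by (metis linorder_less_linear)
  then show "essentially_nowhere_smooth M"
    using irrational_eigenvalues_essentially_nowhere_smooth AM by metis
next
  fix A :: "int ^ 2 ^ 2" and M :: "2 torus set set"
  assume AM: "expanding A \<and> markov_partition (toral_endomorphism A) M"
    and "\<exists>l :: complex. complex_eigenvalue A l \<and> l \<notin> \<real> \<and> \<not> (\<exists>q\<in>\<rat>. Arg l = q * pi)"
  then show "nowhere_differentiable M"
    using nonreal_eigenvalue_nowhere_differentiable by metis
next
  fix A :: "int ^ 2 ^ 2" and M :: "2 torus set set"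
  assume "expanding A \<and> markov_partition (toral_endomorphism A) M" "\<not> complex_diagonalizable A"
  then show "\<not> smooth_partition M"
    using nondiagonalizable_not_smooth by metis
next
  show "\<exists>(A :: int ^ 2 ^ 2) (M :: 2 torus set set).
           expanding A \<and> \<not> complex_diagonalizable A \<and>
           markov_partition (toral_endomorphism A) M \<and> hybrid_partition M"
    using expanding_shear_matrix not_complex_diagonalizable_shear_matrix
      markov_partition_tiling hybrid_partition_tiling by metis
qed

end
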